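(* For every fixed integer $d\geq 3$, if $G$ is the uniformly random $d$-regular graph on the vertex set $[n]$ (with $dn$ even), then with probability tending to $1$ as $n\to\infty$ the following hold: (1) for every integer $k$ with $\frac{d}{2}+\sqrt{d}\leq k\leq d$, $r_\ell(G,\mathcal{K}^E_k)=d-k+1$; (2) for every integer $k$ with $1\leq k<\frac{d}{2}+\sqrt{d}$, $\frac{d}{2}-\sqrt{d}< r_\ell(G,\mathcal{K}^E_k)\leq\min\{d-k+1,\frac{d}{2}+4\sqrt{d\ln d}\}$.
   Context: For a monotone increasing graph property $\mathcal{P}$ (closed under adding edges) and a graph $G$, the local resilience is $r_\ell(G,\mathcal{P})=\min\{r: \exists H\subseteq G \text{ with } \Delta(H)=r \text{ and } G- H\notin\mathcal{P}\}$, where $H\subseteq G$ is a subgraph on the same vertex set, $\Delta(H)$ its maximum degree, and $G-H$ the graph obtained by deleting the edges of $H$. $\mathcal{K}^E_k$ denotes the property of being $k$-edge connected (removing any $k-1$ edges leaves the graph connected). *)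

theory Defs
  imports "HOL-Probability.Probability" "HOL-Library.Ramsey"
begin

type_synonym 'a sgraph = "'a set \<times> 'a set set"

abbreviation verts :: "'a sgraph \<Rightarrow> 'a set" where
  "verts G \<equiv> fst G"

abbreviation edges :: "'a sgraph \<Rightarrow> 'a set set" where
  "edges G \<equiv> snd G"

definition simple_graph :: "'a sgraph \<Rightarrow> bool" where
  "simple_graph G \<longleftrightarrow> finite (verts G) \<and> edges G \<subseteq> nsets (verts G) 2"

definition degree :: "'a sgraph \<Rightarrow> 'a \<Rightarrow> nat" where
  "degree G v = card {e \<in> edges G. v \<in> e}"

definition max_degree :: "'a sgraph \<Rightarrow> nat" where
  "max_degree G = Max (degree G ` verts G)"

definition spanning_subgraph :: "'a sgraph \<Rightarrow> 'a sgraph \<Rightarrow> bool" where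
  "spanning_subgraph H G \<longleftrightarrow> verts H = verts G \<and> edges H \<subseteq> edges G"

definition delete_edges :: "'a sgraph \<Rightarrow> 'a set set \<Rightarrow> 'a sgraph" where
  "delete_edges G F = (verts G, edges G - F)"

definition connected_graph :: "'a sgraph \<Rightarrow> bool" where
  "connected_graph G \<longleftrightarrow> verts G \<noteq> {} \<and>
     (\<forall>u\<in>verts G. \<forall>v\<in>verts G. (u, v) \<in> {(x, y). {x, y} \<in> edges G}\<^sup>*)"

(* Every set of at most k - 1 edges is quantified over, not only those of size exactly k - 1:
   otherwise a graph with fewer than k - 1 edges would satisfy the property vacuously, and
   the property would not be closed under adding edges. *)
definition edge_connected :: "nat \<Rightarrow> 'a sgraph \<Rightarrow> bool" where
  "edge_connected k G \<longleftrightarrow>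
     (\<forall>F \<subseteq> edges G. card F < k \<longrightarrow> connected_graph (delete_edges G F))"

(* LEAST is the intended minimum only if some H destroys P.  For edge connectivity (k > 0)
   of a simple graph on at least two vertices, H = G does. *)
definition local_resilience :: "'a sgraph \<Rightarrow> ('a sgraph \<Rightarrow> bool) \<Rightarrow> nat" where
  "local_resilience G P =
     (LEAST r. \<exists>H. spanning_subgraph H G \<and> max_degree H = r \<and> \<not> P (delete_edges G (edges H)))"

(* Finite, and nonempty whenever d < n and d * n is even. *)
definition regular_graphs :: "nat \<Rightarrow> nat \<Rightarrow> nat sgraph set" where
  "regular_graphs d n =
     {G. simple_graph G \<and> verts G = {1..n} \<and> (\<forall>v\<in>verts G. degree G v = d)}"

definition random_regular_graph :: "nat \<Rightarrow> nat \<Rightarrow> nat sgraph pmf" where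
  "random_regular_graph d n = pmf_of_set (regular_graphs d n)"

end

theory Submission
  imports Defs "HOL-Real_Asymp.Real_Asymp"
begin

text \<open>
  Deleting a subgraph of maximum degree \<open>r\<close> removes at most \<open>r * card S\<close> edges from the cut around \<open>S\<close>.
  So the lower bounds follow once, for every integer \<open>D \<le> d/2 - sqrt d\<close>, every nonempty \<open>S\<close> with at most
  \<open>n/2\<close> vertices sends at least \<open>d + D * (card S - 1)\<close> edges to its complement.
  The upper bound \<open>d - k + 1\<close> comes from a star. The other one is deterministic: by the argument of Stiebitz
  every \<open>d\<close>-regular graph has a vertex partition in which each vertex has at least \<open>(d - 1) div 2\<close>
  neighbours on its own side, and one deletes the cut.

  The expansion is a first moment computation, done by switchings directly in the uniform model of simple graphs.
  Replacing edges \<open>ab\<close> inside \<open>S\<close> and \<open>ce\<close> outside \<open>S\<close> by \<open>ac\<close> and \<open>be\<close> compares the number of graphs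
  whose cut at \<open>S\<close> has size \<open>k\<close> with the number for \<open>k + 2\<close>. Iterating this up to the typical cut size gives
  the probability that the configuration model would give, up to a constant factor. The resulting exponent exceeds the
  binomial entropy of \<open>\<alpha> = card S / n\<close>: divided by \<open>\<alpha>\<close>, the difference is decreasing on \<open>(0, 1/2]\<close>,
  and at \<open>\<alpha> = 1/2\<close> it is positive because \<open>ln 2 < 1\<close>. For sets of size at most \<open>n powr (1/32)\<close>
  the first \<open>2 * (card S - 1)\<close> steps suffice, and sets of at most four vertices cannot span enough edges to violate the bound.
\<close>

section \<open>Neighbourhoods, cuts and switchings\<close>

definition nbrs :: "'a sgraph \<Rightarrow> 'a \<Rightarrow> 'a set" where
  "nbrs G v = {u. {v, u} \<in> edges G}"

text \<open>Ordered pairs make degree sums exact: an edge between disjoint sets is counted once, an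
  inner edge of \<open>A\<close> twice in \<open>arcs G A A\<close>.\<close>

definition arcs :: "'a sgraph \<Rightarrow> 'a set \<Rightarrow> 'a set \<Rightarrow> ('a \<times> 'a) set" where
  "arcs G A B = {(u, v). u \<in> A \<and> v \<in> B \<and> {u, v} \<in> edges G}"

lemma simple_graph_edgeD:
  assumes "simple_graph G" "{u, v} \<in> edges G"
  shows "u \<in> verts G" "v \<in> verts G" "u \<noteq> v"
  using assms by (auto simp: simple_graph_def nsets_def card_insert_if split: if_splits)

lemma simple_graph_edgeE:
  assumes "simple_graph G" "e \<in> edges G"
  obtains u v where "e = {u, v}" "u \<noteq> v" "u \<in> verts G" "v \<in> verts G"
  using assms by (auto simp: simple_graph_def nsets_def card_2_iff)

lemma finite_edges: "simple_graph G \<Longrightarrow> finite (edges G)"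
  unfolding simple_graph_def by (meson finite_imp_finite_nsets finite_subset)

lemma nbrs_subset: "simple_graph G \<Longrightarrow> nbrs G v \<subseteq> verts G"
  unfolding nbrs_def using simple_graph_edgeD(2) by fastforce

lemma finite_nbrs: "simple_graph G \<Longrightarrow> finite (nbrs G v)"
  by (rule finite_subset[OF nbrs_subset]) (simp_all add: simple_graph_def)

lemma degree_eq_card_nbrs:
  assumes "simple_graph G"
  shows "degree G v = card (nbrs G v)"
proof -
  have "{e \<in> edges G. v \<in> e} = (\<lambda>u. {v, u}) ` nbrs G v"
  proof (intro equalityI subsetI)
    fix e assume e: "e \<in> {e \<in> edges G. v \<in> e}"
    then obtain x y where "e = {x, y}" using simple_graph_edgeE[OF assms] by blast
    with e show "e \<in> (\<lambda>u. {v, u}) ` nbrs G v"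
      by (auto simp: nbrs_def insert_commute)
  qed (auto simp: nbrs_def)
  moreover have "inj_on (\<lambda>u. {v, u}) (nbrs G v)"
    by (auto simp: inj_on_def doubleton_eq_iff)
  ultimately show ?thesis by (simp add: degree_def card_image)
qed

lemma arcs_eq_Sigma: "arcs G A B = Sigma A (\<lambda>u. nbrs G u \<inter> B)"
  by (auto simp: arcs_def nbrs_def)

lemma card_arcs:
  assumes "simple_graph G" "finite A"
  shows "card (arcs G A B) = (\<Sum>u\<in>A. card (nbrs G u \<inter> B))"
  unfolding arcs_eq_Sigma using assms(2) finite_nbrs[OF assms(1)] by (subst card_SigmaI) auto

lemma finite_arcs: "finite A \<Longrightarrow> simple_graph G \<Longrightarrow> finite (arcs G A B)"
  unfolding arcs_eq_Sigma by (intro finite_SigmaI) (auto intro: finite_nbrs)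

lemma card_arcs_swap: "card (arcs G A B) = card (arcs G B A)"
proof -
  have "arcs G B A = prod.swap ` arcs G A B"
    by (auto simp: arcs_def image_iff insert_commute)
  thus ?thesis by (simp add: card_image)
qed

lemma card_arcs_split:
  assumes "simple_graph G" "finite A" "B \<subseteq> C"
  shows "card (arcs G A C) = card (arcs G A B) + card (arcs G A (C - B))"
proof -
  have "arcs G A C = arcs G A B \<union> arcs G A (C - B)" using assms(3) by (auto simp: arcs_def)
  moreover have "arcs G A B \<inter> arcs G A (C - B) = {}" by (auto simp: arcs_def)
  ultimately show ?thesis using finite_arcs[OF assms(2,1)] by (simp add: card_Un_disjoint)
qed

lemma regular_graphsD:
  assumes "G \<in> regular_graphs d n"
  shows "simple_graph G" "verts G = {1..n}" "v \<in> {1..n} \<Longrightarrow> card (nbrs G v) = d"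
  using assms degree_eq_card_nbrs[of G v] by (auto simp: regular_graphs_def)

lemma finite_regular_graphs: "finite (regular_graphs d n)"
proof (rule finite_subset)
  show "regular_graphs d n \<subseteq> {{1..n}} \<times> Pow (nsets {1..n} 2)"
    by (auto simp: regular_graphs_def simple_graph_def)
qed (auto intro: finite_imp_finite_nsets)

lemma card_arcs_regular:
  assumes G: "G \<in> regular_graphs d n" and A: "A \<subseteq> {1..n}"
  shows "card (arcs G A {1..n}) = d * card A"
proof -
  note R = regular_graphsD[OF G]
  have "card (arcs G A {1..n}) = (\<Sum>u\<in>A. card (nbrs G u \<inter> {1..n}))"
    using A by (intro card_arcs R) (auto intro: finite_subset)
  also have "\<dots> = (\<Sum>u\<in>A. d)"
  proof (rule sum.cong[OF refl])
    fix u assume "u \<in> A"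
    moreover have "nbrs G u \<inter> {1..n} = nbrs G u" using nbrs_subset[OF R(1)] R(2) by auto
    ultimately show "card (nbrs G u \<inter> {1..n}) = d" using R(3) A by auto
  qed
  finally show ?thesis by simp
qed

lemma card_inner_arcs_regular:
  assumes G: "G \<in> regular_graphs d n" and A: "A \<subseteq> {1..n}"
  shows "card (arcs G A A) + card (arcs G A ({1..n} - A)) = d * card A"
  using card_arcs_split[of G A A "{1..n}"] card_arcs_regular[OF G A] regular_graphsD[OF G] A
  by (simp add: finite_subset)

section \<open>Switchings across a vertex cut\<close>

definition switch :: "'a sgraph \<Rightarrow> 'a \<Rightarrow> 'a \<Rightarrow> 'a \<Rightarrow> 'a \<Rightarrow> 'a sgraph" where
  "switch G a b c e = (verts G, edges G - {{a, b}, {c, e}} \<union> {{a, c}, {b, e}})"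

definition switchings :: "'a sgraph \<Rightarrow> 'a set \<Rightarrow> 'a set \<Rightarrow> (('a \<times> 'a) \<times> 'a \<times> 'a) set" where
  "switchings G A B = {((a, b), (c, e)). (a, b) \<in> arcs G A A \<and> (c, e) \<in> arcs G B B
      \<and> {a, c} \<notin> edges G \<and> {b, e} \<notin> edges G}"

text \<open>Each of the four vertices loses one edge and gains one; degrees are compared as sums of
  indicators over the edge sets.\<close>

lemma switch_regular:
  assumes G: "G \<in> regular_graphs d n" and A: "A \<subseteq> {1..n}"
    and sw: "((a, b), (c, e)) \<in> switchings G A ({1..n} - A)"
  shows "switch G a b c e \<in> regular_graphs d n"
proof -
  note R = regular_graphsD[OF G]
  have ab: "{a, b} \<in> edges G" "{c, e} \<in> edges G" "a \<in> A" "b \<in> A" "c \<in> {1..n} - A" "e \<in> {1..n} - A"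
    and new: "{a, c} \<notin> edges G" "{b, e} \<notin> edges G"
    using sw by (auto simp: switchings_def arcs_def)
  have ne: "a \<noteq> b" "c \<noteq> e" using simple_graph_edgeD(3)[OF R(1)] ab by auto
  let ?E' = "edges G - {{a, b}, {c, e}} \<union> {{a, c}, {b, e}}"
  have fin: "finite (edges G)" using finite_edges R by blast
  have deg: "card {x \<in> ?E'. v \<in> x} = card {x \<in> edges G. v \<in> x}" for v
  proof -
    let ?f = "\<lambda>x. if v \<in> x then 1 else 0 :: nat"
    have card: "card {x \<in> F. v \<in> x} = sum ?f F" if "finite F" for F
      using that by (simp add: sum.If_cases Int_def)
    have "sum ?f (edges G) = sum ?f (edges G - {{a, b}, {c, e}}) + sum ?f {{a, b}, {c, e}}"
      using ab fin by (intro sum.subset_diff) auto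
    moreover have "sum ?f ?E' = sum ?f (edges G - {{a, b}, {c, e}}) + sum ?f {{a, c}, {b, e}}"
      using new fin by (intro sum.union_disjoint) auto
    moreover have "{a, b} \<noteq> {c, e}" "{a, c} \<noteq> {b, e}"
      using ab ne by (auto simp: doubleton_eq_iff)
    hence "sum ?f {{a, b}, {c, e}} = sum ?f {{a, c}, {b, e}}"
      using ab ne by auto
    ultimately have "sum ?f ?E' = sum ?f (edges G)" by simp
    thus ?thesis using card[of ?E'] card[of "edges G"] fin by simp
  qed
  have "?E' \<subseteq> nsets {1..n} 2"
    using R A ab ne by (auto simp: simple_graph_def nsets_def card_insert_if)
  thus ?thesis using G deg unfolding switch_def regular_graphs_def degree_def
    by (auto simp: simple_graph_def)
qed

lemma switch_cut:
  assumes G: "G \<in> regular_graphs d n" and A: "A \<subseteq> {1..n}"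
    and sw: "((a, b), (c, e)) \<in> switchings G A ({1..n} - A)"
  shows "arcs (switch G a b c e) A ({1..n} - A) = insert (a, c) (insert (b, e) (arcs G A ({1..n} - A)))"
    and "card (arcs (switch G a b c e) A ({1..n} - A)) = card (arcs G A ({1..n} - A)) + 2"
proof -
  note R = regular_graphsD[OF G]
  have ab: "{a, b} \<in> edges G" "{c, e} \<in> edges G" "a \<in> A" "b \<in> A" "c \<in> {1..n} - A" "e \<in> {1..n} - A"
    and new: "{a, c} \<notin> edges G" "{b, e} \<notin> edges G"
    using sw by (auto simp: switchings_def arcs_def)
  have ne: "a \<noteq> b" "c \<noteq> e" using simple_graph_edgeD(3)[OF R(1)] ab by auto
  show eq: "arcs (switch G a b c e) A ({1..n} - A)
      = insert (a, c) (insert (b, e) (arcs G A ({1..n} - A)))"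
  proof (intro set_eqI)
    fix p :: "nat \<times> nat"
    obtain u v where p: "p = (u, v)" by (cases p)
    show "p \<in> arcs (switch G a b c e) A ({1..n} - A)
      \<longleftrightarrow> p \<in> insert (a, c) (insert (b, e) (arcs G A ({1..n} - A)))"
    proof (cases "u \<in> A \<and> v \<in> {1..n} - A")
      case True
      hence "{u, v} \<noteq> {a, b}" "{u, v} \<noteq> {c, e}" "{u, v} = {a, c} \<longleftrightarrow> u = a \<and> v = c"
        "{u, v} = {b, e} \<longleftrightarrow> u = b \<and> v = e"
        using ab(3-6) by (force simp: doubleton_eq_iff)+
      thus ?thesis using True by (simp add: p arcs_def switch_def)
    next
      case False
      thus ?thesis using ab(3-6) unfolding p arcs_def by blast
    qed
  qed
  have "finite (arcs G A ({1..n} - A))"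
    using A R by (intro finite_arcs) (auto intro: finite_subset)
  moreover have "(a, c) \<noteq> (b, e)" "(a, c) \<notin> arcs G A ({1..n} - A)" "(b, e) \<notin> arcs G A ({1..n} - A)"
    using new ne by (auto simp: arcs_def)
  ultimately show "card (arcs (switch G a b c e) A ({1..n} - A)) = card (arcs G A ({1..n} - A)) + 2"
    unfolding eq by simp
qed

text \<open>The new edges were absent and the old ones present, so the result and the four vertices
  determine the original graph. This gives injectivity in the double count.\<close>

lemma switch_undo:
  assumes "((a, b), (c, e)) \<in> switchings G A B"
  shows "G = (verts G, edges (switch G a b c e) - {{a, c}, {b, e}} \<union> {{a, b}, {c, e}})"
  using assms by (auto simp: switchings_def switch_def arcs_def prod_eq_iff)

text \<open>The two sides have \<open>d * card A - k\<close> and \<open>d * (n - card A) - k\<close>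
  ordered inner arcs. For a fixed arc \<open>(a, b)\<close>, existing edges \<open>{a, c}\<close> or
  \<open>{b, e}\<close> rule out at most \<open>2 * d^2\<close> partners.\<close>

lemma card_switchings:
  assumes G: "G \<in> regular_graphs d n" and A: "A \<subseteq> {1..n}"
    and k: "card (arcs G A ({1..n} - A)) = k"
  shows "(real (d * card A) - real k) * (real (d * (n - card A)) - real k - 2 * real d ^ 2)
    \<le> real (card (switchings G A ({1..n} - A)))"
proof -
  note R = regular_graphsD[OF G]
  let ?B = "{1..n} - A"
  have finA: "finite A" using A by (rule finite_subset) simp
  have cB: "card ?B = n - card A" using A finA by (simp add: card_Diff_subset)
  have "card (arcs G ?B A) = k" using k card_arcs_swap by metis
  moreover have "{1..n} - ?B = A" using A by auto
  ultimately have BB: "card (arcs G ?B ?B) + k = d * (n - card A)"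
    using card_inner_arcs_regular[OF G, of ?B] cB by simp
  have AA: "card (arcs G A A) + k = d * card A" using card_inner_arcs_regular[OF G A] k by simp
  \<comment> \<open>The pairs \<open>(c, e)\<close> for which \<open>a, c, e\<close> or
    \<open>b, e, c\<close> is a walk; there are \<open>d^2\<close> of each kind.\<close>
  define bad where "bad = (\<lambda>(a, b). Sigma (nbrs G a) (nbrs G) \<union> prod.swap ` Sigma (nbrs G b) (nbrs G))"
  have eq: "switchings G A ?B = Sigma (arcs G A A) (\<lambda>p. arcs G ?B ?B - bad p)"
  proof (intro set_eqI)
    fix x :: "(nat \<times> nat) \<times> nat \<times> nat"
    obtain a b c e where x: "x = ((a, b), (c, e))" by (metis surj_pair)
    have "(c, e) \<in> bad (a, b) \<longleftrightarrow> {a, c} \<in> edges G \<and> {c, e} \<in> edges G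
        \<or> {b, e} \<in> edges G \<and> {e, c} \<in> edges G"
      unfolding bad_def nbrs_def by auto
    moreover have "{e, c} = {c, e}" by auto
    ultimately show "x \<in> switchings G A ?B \<longleftrightarrow> x \<in> Sigma (arcs G A A) (\<lambda>p. arcs G ?B ?B - bad p)"
      unfolding x switchings_def by (auto simp: arcs_def)
  qed
  have two: "card (Sigma (nbrs G a) (nbrs G)) = d * d" if "a \<in> A" for a
  proof -
    have "card (Sigma (nbrs G a) (nbrs G)) = (\<Sum>c\<in>nbrs G a. card (nbrs G c))"
      using finite_nbrs[OF R(1)] by simp
    also have "\<dots> = (\<Sum>c\<in>nbrs G a. d)"
      using nbrs_subset[OF R(1)] R(2) by (intro sum.cong[OF refl] R(3)) blast
    also have "\<dots> = d * d" using R(3)[of a] that A by auto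
    finally show ?thesis .
  qed
  have finS: "finite (Sigma (nbrs G a) (nbrs G))" for a
    using finite_nbrs[OF R(1)] by auto
  have fibre: "real (d * (n - card A)) - real k - 2 * real d ^ 2 \<le> real (card (arcs G ?B ?B - bad p))"
    if p: "p \<in> arcs G A A" for p
  proof -
    obtain a b where ab: "p = (a, b)" "a \<in> A" "b \<in> A" using p by (auto simp: arcs_def)
    have "card (bad p) \<le> d * d + d * d"
      unfolding ab bad_def
      using card_Un_le[of "Sigma (nbrs G a) (nbrs G)" "prod.swap ` Sigma (nbrs G b) (nbrs G)"]
      by (simp add: card_image two ab del: card_SigmaI)
    moreover have "card (arcs G ?B ?B) - card (bad p) \<le> card (arcs G ?B ?B - bad p)"
      using finS by (intro diff_card_le_card_Diff) (auto simp: ab bad_def)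
    ultimately have "card (arcs G ?B ?B) \<le> card (arcs G ?B ?B - bad p) + 2 * d ^ 2"
      by (simp add: power2_eq_square)
    hence "real (card (arcs G ?B ?B)) \<le> real (card (arcs G ?B ?B - bad p) + 2 * d ^ 2)"
      using of_nat_mono by blast
    thus ?thesis using BB[symmetric] by simp
  qed
  have "real (card (arcs G A A)) * (real (d * (n - card A)) - real k - 2 * real d ^ 2)
      = (\<Sum>p\<in>arcs G A A. real (d * (n - card A)) - real k - 2 * real d ^ 2)" by simp
  also have "\<dots> \<le> (\<Sum>p\<in>arcs G A A. real (card (arcs G ?B ?B - bad p)))"
    using fibre by (rule sum_mono)
  also have "\<dots> = real (card (switchings G A ?B))"
    unfolding eq using finA R(1) by (subst card_SigmaI) (auto intro: finite_arcs)
  finally show ?thesis using AA[symmetric] by simp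
qed

definition cut_graphs :: "nat \<Rightarrow> nat \<Rightarrow> nat set \<Rightarrow> nat \<Rightarrow> nat sgraph set" where
  "cut_graphs d n A k = {G \<in> regular_graphs d n. card (arcs G A ({1..n} - A)) = k}"

text \<open>Double counting: a switching is sent to the new graph together with the ordered pair of
  cut arcs it created. These arcs name all four vertices, so the map is injective, and each target
  graph has \<open>(k + 2) * (k + 1)\<close> such pairs.\<close>

lemma card_cut_graphs_switching:
  assumes A: "A \<subseteq> {1..n}"
  shows "real (card (cut_graphs d n A k)) *
      ((real (d * card A) - real k) * (real (d * (n - card A)) - real k - 2 * real d ^ 2))
    \<le> real (card (cut_graphs d n A (k + 2))) * (real (k + 2) * real (k + 1))"
proof -
  let ?B = "{1..n} - A"
  have finA: "finite A" using A by (rule finite_subset) simp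
  have fin: "finite (cut_graphs d n A j)" for j
    unfolding cut_graphs_def using finite_regular_graphs by auto
  have finarc: "finite (arcs G X Y)" if "G \<in> cut_graphs d n A j" "X \<subseteq> {1..n}" for G X Y j
  proof (rule finite_arcs)
    show "finite X" using that(2) by (rule finite_subset) simp
    show "simple_graph G" using that(1) regular_graphsD(1) unfolding cut_graphs_def by blast
  qed
  have finsw: "finite (switchings G A ?B)" if "G \<in> cut_graphs d n A j" for G j
  proof (rule finite_subset)
    show "switchings G A ?B \<subseteq> arcs G A A \<times> arcs G ?B ?B" by (auto simp: switchings_def)
    show "finite (arcs G A A \<times> arcs G ?B ?B)"
      using finarc[OF that] A by (intro finite_cartesian_product) auto
  qed
  define src where "src = Sigma (cut_graphs d n A k) (\<lambda>G. switchings G A ?B)"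
  define trg where "trg = Sigma (cut_graphs d n A (k + 2))
     (\<lambda>G. arcs G A ?B \<times> arcs G A ?B - Id)"
  define f where "f = (\<lambda>(G :: nat sgraph, (a, b), (c, e)). (switch G a b c e, (a, c), (b, e)))"
  have fin_fibre: "finite (arcs G A ?B \<times> arcs G A ?B - Id)" if "G \<in> cut_graphs d n A (k + 2)" for G
    using finarc[OF that A] by blast
  have fin_trg: "finite trg" unfolding trg_def using fin fin_fibre by (rule finite_SigmaI)
  have card_trg: "card trg = card (cut_graphs d n A (k + 2)) * ((k + 2) * (k + 1))"
  proof -
    have "card (arcs G A ?B \<times> arcs G A ?B - Id) = (k + 2) * (k + 1)" if "G \<in> cut_graphs d n A (k + 2)" for G
    proof -
      let ?X = "arcs G A ?B"
      have c: "card ?X = k + 2" "finite ?X" using that finarc[OF that A] by (auto simp: cut_graphs_def)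
      have "?X \<times> ?X - Id = ?X \<times> ?X - Id_on ?X" by auto
      moreover have "card (Id_on ?X) = card ?X"
      proof -
        have "Id_on ?X = (\<lambda>x. (x, x)) ` ?X" by (auto simp: Id_on_def)
        thus ?thesis by (simp add: card_image inj_on_def)
      qed
      moreover have "Id_on ?X \<subseteq> ?X \<times> ?X" "finite (Id_on ?X)"
        using c(2) by (auto simp: Id_on_def)
      ultimately show ?thesis using c
        by (simp add: card_Diff_subset card_cartesian_product algebra_simps)
    qed
    thus ?thesis unfolding trg_def using fin fin_fibre by (subst card_SigmaI) simp_all
  qed
  have sub: "f ` src \<subseteq> trg"
  proof
    fix z assume "z \<in> f ` src"
    moreover obtain G p q where z: "z = (G, p, q)" by (cases z)
    ultimately have "(G, p, q) \<in> f ` src" by simp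
    then obtain G0 a b c e where x: "(G, p, q) = f (G0, (a, b), (c, e))"
        "G0 \<in> cut_graphs d n A k" "((a, b), (c, e)) \<in> switchings G0 A ?B"
      unfolding src_def by auto
    have G0: "G0 \<in> regular_graphs d n" using x by (simp add: cut_graphs_def)
    have "switch G0 a b c e \<in> cut_graphs d n A (k + 2)"
      using switch_regular[OF G0 A x(3)] switch_cut(2)[OF G0 A x(3)] x(2) by (simp add: cut_graphs_def)
    moreover have "(a, c) \<noteq> (b, e)"
      using x(3) simple_graph_edgeD(3)[OF regular_graphsD(1)[OF G0]] by (auto simp: switchings_def arcs_def)
    ultimately show "z \<in> trg"
      using x(1) z switch_cut(1)[OF G0 A x(3)] by (auto simp: trg_def f_def)
  qed
  have inj: "inj_on f src"
  proof (rule inj_onI)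
    fix x y assume x: "x \<in> src" and y: "y \<in> src" and xy: "f x = f y"
    obtain G a b c e where x': "x = (G, (a, b), (c, e))" by (cases x) auto
    obtain H a' b' c' e' where y': "y = (H, (a', b'), (c', e'))" by (cases y) auto
    have same: "a' = a" "b' = b" "c' = c" "e' = e" "switch G a b c e = switch H a b c e"
      using xy by (auto simp: x' y' f_def)
    have "verts G = verts H" using same(5) by (simp add: switch_def)
    moreover have "((a, b), (c, e)) \<in> switchings G A ?B" "((a, b), (c, e)) \<in> switchings H A ?B"
      using x y unfolding src_def x' y' same(1-4) by blast+
    ultimately have "G = H"
      using switch_undo[of a b c e G A ?B] switch_undo[of a b c e H A ?B] same(5) by simp
    thus "x = y" using same by (simp add: x' y')
  qed
  have le: "card src \<le> card trg" using card_inj_on_le[OF inj sub fin_trg] .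
  have "real (card (cut_graphs d n A k)) *
      ((real (d * card A) - real k) * (real (d * (n - card A)) - real k - 2 * real d ^ 2))
     = (\<Sum>G\<in>cut_graphs d n A k. (real (d * card A) - real k) * (real (d * (n - card A)) - real k - 2 * real d ^ 2))"
    by simp
  also have "\<dots> \<le> (\<Sum>G\<in>cut_graphs d n A k. real (card (switchings G A ?B)))"
    by (intro sum_mono card_switchings A) (auto simp: cut_graphs_def)
  also have "\<dots> = real (card src)"
    unfolding src_def using fin finsw by (subst card_SigmaI) simp_all
  also have "\<dots> \<le> real (card trg)" using le by simp
  finally show ?thesis unfolding card_trg by (simp only: of_nat_mult)
qed

section \<open>Internal partitions\<close>

definition inner_degree_ge :: "'a sgraph \<Rightarrow> nat \<Rightarrow> 'a set \<Rightarrow> bool" where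
  "inner_degree_ge G t A \<longleftrightarrow> A \<noteq> {} \<and> A \<subseteq> verts G \<and> (\<forall>v\<in>A. t \<le> card (nbrs G v \<inter> A))"

text \<open>This is \<open>t\<close>-degeneracy of the subgraph induced on \<open>A\<close>.\<close>

definition meagre :: "'a sgraph \<Rightarrow> nat \<Rightarrow> 'a set \<Rightarrow> bool" where
  "meagre G t A \<longleftrightarrow> A \<subseteq> verts G \<and> (\<forall>B\<subseteq>A. \<not> inner_degree_ge G (Suc t) B)"

lemma meagre_subset: "meagre G t A \<Longrightarrow> B \<subseteq> A \<Longrightarrow> meagre G t B"
  unfolding meagre_def by blast

lemma meagre_low_degree:
  assumes "meagre G t A" "A \<noteq> {}"
  obtains x where "x \<in> A" "card (nbrs G x \<inter> A) \<le> t"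
proof -
  have "\<not> inner_degree_ge G (Suc t) A" "A \<subseteq> verts G"
    using assms(1) unfolding meagre_def by blast+
  then obtain x where "x \<in> A" "\<not> Suc t \<le> card (nbrs G x \<inter> A)"
    using assms(2) unfolding inner_degree_ge_def by blast
  thus thesis using that by force
qed

text \<open>Losing one vertex costs every other vertex at most one neighbour. This makes overlapping
  dense sets disjoint at the price of one in the degree.\<close>

lemma inner_degree_ge_remove:
  assumes G: "simple_graph G" and A: "inner_degree_ge G (Suc t) A"
  shows "inner_degree_ge G t (A - {x})"
  unfolding inner_degree_ge_def
proof (intro conjI ballI)
  note A' = A[unfolded inner_degree_ge_def]
  show "A - {x} \<noteq> {}"
  proof
    assume "A - {x} = {}"
    with A' have "A = {x}" by blast
    moreover have "x \<notin> nbrs G x" using simple_graph_edgeD(3)[OF G, of x x] by (auto simp: nbrs_def)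
    ultimately have "nbrs G x \<inter> A = {}" by auto
    thus False using A' \<open>A = {x}\<close> by simp
  qed
  show "A - {x} \<subseteq> verts G" using A' by blast
  fix v assume "v \<in> A - {x}"
  hence "Suc t \<le> card (nbrs G v \<inter> A)" using A' by blast
  also have "\<dots> \<le> card (insert x (nbrs G v \<inter> (A - {x})))"
    using finite_nbrs[OF G] by (intro card_mono) auto
  also have "\<dots> \<le> Suc (card (nbrs G v \<inter> (A - {x})))" by (rule card_insert_le_m1) simp_all
  finally show "t \<le> card (nbrs G v \<inter> (A - {x}))" by simp
qed

lemma card_arcs_singleton: "simple_graph G \<Longrightarrow> card (arcs G {x} B) = card (nbrs G x \<inter> B)"
  by (simp add: card_arcs)

lemma cut_move:
  assumes G: "simple_graph G" and A: "A \<subseteq> verts G" and x: "x \<in> A"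
  shows "card (arcs G (A - {x}) (verts G - (A - {x}))) + card (nbrs G x \<inter> (verts G - A))
       = card (arcs G A (verts G - A)) + card (nbrs G x \<inter> A)"
proof -
  let ?B = "verts G - A"
  have fin: "finite A" using A G by (auto simp: simple_graph_def intro: finite_subset)
  have "x \<notin> nbrs G x" using simple_graph_edgeD(3)[OF G, of x x] by (auto simp: nbrs_def)
  hence N: "nbrs G x \<inter> (A - {x}) = nbrs G x \<inter> A" by auto
  have "verts G - (A - {x}) = insert x ?B" using A x by auto
  moreover have "insert x ?B - {x} = ?B" using x by auto
  ultimately have 1: "card (arcs G (A - {x}) (verts G - (A - {x})))
      = card (arcs G (A - {x}) {x}) + card (arcs G (A - {x}) ?B)"
    using card_arcs_split[OF G, of "A - {x}" "{x}" "insert x ?B"] fin by simp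
  have 2: "card (arcs G (A - {x}) {x}) = card (nbrs G x \<inter> A)"
    using card_arcs_swap[of G "A - {x}" "{x}"] card_arcs_singleton[OF G] N by simp
  have "card (arcs G A ?B) = card (arcs G {x} ?B) + card (arcs G (A - {x}) ?B)"
    using card_arcs[OF G] fin x by (simp add: sum.remove)
  thus ?thesis using 1 2 card_arcs_singleton[OF G, of x ?B] by simp
qed

text \<open>
  Without such a pair, among the partitions into two meagre sets take one with minimum cut. Moving a vertex of low
  inner degree across decreases the cut, so the other side stops being meagre; the dense sets that this
  creates on the two sides, each without the vertex moved in the opposite direction, form a pair.
\<close>

lemma disjoint_dense_pair:
  assumes G: "simple_graph G" and ne: "verts G \<noteq> {}"
    and deg: "\<And>v. v \<in> verts G \<Longrightarrow> 2 * t + 1 \<le> card (nbrs G v)"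
  shows "\<exists>A B. inner_degree_ge G t A \<and> inner_degree_ge G t B \<and> A \<inter> B = {}"
proof (rule ccontr)
  assume no: "\<not> ?thesis"
  let ?V = "verts G"
  have finV: "finite ?V" using G by (simp add: simple_graph_def)
  have NV: "nbrs G v \<inter> ?V = nbrs G v" for v using nbrs_subset[OF G] by blast
  have dense_V: "inner_degree_ge G (Suc t) ?V"
    unfolding inner_degree_ge_def NV using ne deg by force
  have V: "\<not> meagre G t ?V" unfolding meagre_def using dense_V by blast
  have weaken: "inner_degree_ge G t A" if "inner_degree_ge G (Suc t) A" for A
    using that unfolding inner_degree_ge_def by (meson Suc_leD)
  define P where "P = (\<lambda>A. A \<subseteq> ?V \<and> meagre G t A \<and> meagre G t (?V - A))"
  \<comment> \<open>A largest meagre \<open>A\<close> works: if its complement contained a dense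
    \<open>B\<close>, adding a vertex \<open>y\<close> to \<open>A\<close> would create a dense
    \<open>C\<close>, and \<open>C - {y}\<close> and \<open>B\<close> would be the excluded
    pair.\<close>
  have "\<exists>A. P A"
  proof -
    have "meagre G t {}" unfolding meagre_def inner_degree_ge_def by blast
    moreover have "\<forall>A. meagre G t A \<longrightarrow> card A < Suc (card ?V)"
      unfolding meagre_def using card_mono[OF finV] by (simp add: less_Suc_eq_le)
    ultimately obtain A where A: "meagre G t A" "\<And>B. meagre G t B \<Longrightarrow> card B \<le> card A"
      using ex_has_greatest_nat[of "meagre G t" "{}" card] by blast
    have AV: "A \<subseteq> ?V" using A(1) unfolding meagre_def by blast
    have "meagre G t (?V - A)"
    proof (rule ccontr)
      assume "\<not> meagre G t (?V - A)"
      then obtain B where B: "B \<subseteq> ?V - A" "inner_degree_ge G (Suc t) B"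
        unfolding meagre_def by blast
      have "A \<noteq> ?V" using V A(1) by auto
      then obtain y where y: "y \<in> ?V - A" using AV by blast
      have "card (insert y A) = Suc (card A)" using y AV finV by (simp add: finite_subset)
      hence "\<not> meagre G t (insert y A)" using A(2)[of "insert y A"] by auto
      then obtain C where C: "C \<subseteq> insert y A" "inner_degree_ge G (Suc t) C"
        using y AV unfolding meagre_def by blast
      have "(C - {y}) \<inter> B = {}" using B C by blast
      thus False using no inner_degree_ge_remove[OF G C(2)] weaken[OF B(2)] by blast
    qed
    thus ?thesis using A(1) AV unfolding P_def by blast
  qed
  then obtain A where A: "P A" "\<And>B. P B \<Longrightarrow> card (arcs G A (?V - A)) \<le> card (arcs G B (?V - B))"
    using ex_has_least_nat[of P _ "\<lambda>A. card (arcs G A (?V - A))"] by blast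
  have key: "\<exists>x C. x \<in> X \<and> C \<subseteq> insert x (?V - X) \<and> inner_degree_ge G (Suc t) C"
    if X: "P X" and min: "\<And>B. P B \<Longrightarrow> card (arcs G X (?V - X)) \<le> card (arcs G B (?V - B))" for X
  proof -
    have "X \<noteq> {}" using X V unfolding P_def by auto
    then obtain x where x: "x \<in> X" "card (nbrs G x \<inter> X) \<le> t"
      using meagre_low_degree X unfolding P_def by metis
    have XV: "X \<subseteq> ?V" using X unfolding P_def by blast
    have "card (nbrs G x) = card (nbrs G x \<inter> X) + card (nbrs G x \<inter> (?V - X))"
    proof -
      have "nbrs G x = (nbrs G x \<inter> X) \<union> (nbrs G x \<inter> (?V - X))" using NV by blast
      moreover have "(nbrs G x \<inter> X) \<inter> (nbrs G x \<inter> (?V - X)) = {}" by blast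
      ultimately show ?thesis using finite_nbrs[OF G] by (metis card_Un_disjoint finite_Int)
    qed
    \<comment> \<open>Of at least \<open>2 * t + 1\<close> neighbours at most \<open>t\<close> are
      inside, so more lie outside.\<close>
    hence "card (nbrs G x \<inter> X) < card (nbrs G x \<inter> (?V - X))" using x deg[of x] XV by force
    hence "card (arcs G (X - {x}) (?V - (X - {x}))) < card (arcs G X (?V - X))"
      using cut_move[OF G XV x(1)] by linarith
    hence "\<not> P (X - {x})" using min[of "X - {x}"] by force
    moreover have "meagre G t (X - {x})" using X meagre_subset unfolding P_def by blast
    ultimately have "\<not> meagre G t (?V - (X - {x}))" using XV unfolding P_def by blast
    moreover have "?V - (X - {x}) = insert x (?V - X)" using x XV by blast
    ultimately obtain C where "C \<subseteq> insert x (?V - X)" "inner_degree_ge G (Suc t) C"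
      using x XV unfolding meagre_def by auto
    thus ?thesis using x by blast
  qed
  have AV: "A \<subseteq> ?V" using A(1) unfolding P_def by blast
  have dd: "?V - (?V - A) = A" using AV by blast
  obtain x C where x: "x \<in> A" "C \<subseteq> insert x (?V - A)" "inner_degree_ge G (Suc t) C"
    using key[OF A] by blast
  have "P (?V - A)" using A(1) dd unfolding P_def by auto
  moreover have "card (arcs G (?V - A) (?V - (?V - A))) \<le> card (arcs G B (?V - B))" if "P B" for B
    using A(2)[OF that] card_arcs_swap[of G A "?V - A"] unfolding dd by simp
  ultimately obtain y D where y: "y \<in> ?V - A" "D \<subseteq> insert y A" "inner_degree_ge G (Suc t) D"
    using key[of "?V - A"] unfolding dd by blast
  have "(C - {y}) \<inter> (D - {x}) = {}" using x y by blast
  thus False using no inner_degree_ge_remove[OF G x(3)] inner_degree_ge_remove[OF G y(3)] by blast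
qed

text \<open>Take a disjoint dense pair \<open>A\<close>, \<open>B\<close> with largest union. A
  vertex outside \<open>A\<close> with fewer than \<open>t\<close> neighbours outside
  \<open>A\<close> is not in \<open>B\<close> and has at least \<open>t\<close> neighbours in
  \<open>A\<close>, so it could be added to \<open>A\<close>.\<close>

lemma internal_partition:
  assumes G: "simple_graph G" and ne: "verts G \<noteq> {}"
    and deg: "\<And>v. v \<in> verts G \<Longrightarrow> 2 * t + 1 \<le> card (nbrs G v)"
  obtains A where "inner_degree_ge G t A" "inner_degree_ge G t (verts G - A)"
proof -
  let ?V = "verts G"
  have finV: "finite ?V" using G by (simp add: simple_graph_def)
  define P where "P = (\<lambda>(A, B). inner_degree_ge G t A \<and> inner_degree_ge G t B \<and> A \<inter> B = {})"
  define f where "f = (\<lambda>(A :: 'a set, B). card (A \<union> B))"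
  obtain p where "P p" using disjoint_dense_pair[OF assms] unfolding P_def by blast
  moreover have "\<forall>p. P p \<longrightarrow> f p < Suc (card ?V)"
    unfolding P_def f_def inner_degree_ge_def by (auto simp: less_Suc_eq_le intro!: card_mono finV)
  ultimately obtain q where q: "P q" "\<And>p. P p \<Longrightarrow> f p \<le> f q"
    using ex_has_greatest_nat[of P p f] by blast
  obtain A B where AB: "q = (A, B)" by (cases q)
  have A: "inner_degree_ge G t A" and B: "inner_degree_ge G t B" and dis: "A \<inter> B = {}"
    using q(1) unfolding P_def AB by auto
  have sub: "A \<subseteq> ?V" "B \<subseteq> ?V" using A B unfolding inner_degree_ge_def by auto
  have "inner_degree_ge G t (?V - A)"
  proof (rule ccontr)
    assume no: "\<not> ?thesis"
    have "?V - A \<noteq> {}" using B dis sub unfolding inner_degree_ge_def by blast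
    then obtain x where x: "x \<in> ?V - A" "card (nbrs G x \<inter> (?V - A)) < t"
      using no unfolding inner_degree_ge_def by force
    have xB: "x \<notin> B"
    proof
      assume "x \<in> B"
      hence "t \<le> card (nbrs G x \<inter> B)" using B unfolding inner_degree_ge_def by blast
      also have "\<dots> \<le> card (nbrs G x \<inter> (?V - A))"
        using finite_nbrs[OF G] dis sub by (intro card_mono) auto
      finally show False using x by simp
    qed
    have "card (nbrs G x) \<le> card ((nbrs G x \<inter> (?V - A)) \<union> (nbrs G x \<inter> A))"
      using nbrs_subset[OF G] finite_nbrs[OF G] by (intro card_mono) auto
    also have "\<dots> \<le> card (nbrs G x \<inter> (?V - A)) + card (nbrs G x \<inter> A)" by (rule card_Un_le)
    finally have xA: "t \<le> card (nbrs G x \<inter> A)" using x deg[of x] by force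
    have "inner_degree_ge G t (insert x A)"
      unfolding inner_degree_ge_def
    proof (intro conjI ballI)
      fix v assume "v \<in> insert x A"
      hence "t \<le> card (nbrs G v \<inter> A)" using A xA unfolding inner_degree_ge_def by blast
      also have "\<dots> \<le> card (nbrs G v \<inter> insert x A)"
        using finite_nbrs[OF G] by (intro card_mono) auto
      finally show "t \<le> card (nbrs G v \<inter> insert x A)" .
    qed (use x sub in auto)
    hence "P (insert x A, B)" using B dis xB unfolding P_def by auto
    moreover have "f (insert x A, B) = Suc (f q)"
      using x xB sub finV unfolding f_def AB by (simp add: finite_subset)
    ultimately show False using q(2) by fastforce
  qed
  thus thesis using that A by blast
qed

section \<open>Resilience of expanding regular graphs\<close>

lemma spanning_subgraph_simple:
  "simple_graph G \<Longrightarrow> spanning_subgraph H G \<Longrightarrow> simple_graph H"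
  by (auto simp: simple_graph_def spanning_subgraph_def)

lemma degree_le_max_degree: "finite (verts G) \<Longrightarrow> v \<in> verts G \<Longrightarrow> degree G v \<le> max_degree G"
  by (simp add: max_degree_def)

text \<open>If the graph falls apart, the set reached from some vertex or its complement is an
  \<open>S\<close> with at most half the vertices whose cut edges all lie in \<open>H\<close> or
  \<open>F\<close>. There are at most \<open>D * card S + k - 1\<close> of these, fewer than
  \<open>d + D * (card S - 1)\<close> because \<open>k + D <= d\<close>.\<close>

lemma edge_connected_delete_edges:
  assumes G: "simple_graph G" "verts G \<noteq> {}" and H: "spanning_subgraph H G"
    and D: "max_degree H \<le> D" "k + D \<le> d"
    and cut: "\<And>S. S \<subseteq> verts G \<Longrightarrow> S \<noteq> {} \<Longrightarrow> 2 * card S \<le> card (verts G) \<Longrightarrow>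
      d + D * (card S - 1) \<le> card (arcs G S (verts G - S))"
  shows "edge_connected k (delete_edges G (edges H))"
  unfolding edge_connected_def
proof (intro allI impI)
  let ?V = "verts G"
  have finV: "finite ?V" using G by (simp add: simple_graph_def)
  have H': "simple_graph H" "verts H = ?V"
    using spanning_subgraph_simple[OF G(1) H] H by (auto simp: spanning_subgraph_def)
  fix F assume F: "F \<subseteq> edges (delete_edges G (edges H))" "card F < k"
  have finF: "finite F"
    using F(1) finite_edges[OF G(1)] by (auto simp: delete_edges_def intro: finite_subset)
  define r where "r = {(x, y). {x, y} \<in> edges G - edges H - F}"
  show "connected_graph (delete_edges (delete_edges G (edges H)) F)"
  proof (rule ccontr)
    assume "\<not> ?thesis"
    then obtain u v where uv: "u \<in> ?V" "v \<in> ?V" "(u, v) \<notin> r\<^sup>*"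
      using G(2) by (auto simp: connected_graph_def delete_edges_def r_def)
    define U where "U = {w \<in> ?V. (u, w) \<in> r\<^sup>*}"
    have U: "U \<subseteq> ?V" "u \<in> U" "v \<in> ?V - U" using uv by (auto simp: U_def)
    have closed: "{x, y} \<notin> edges G - edges H - F" if "x \<in> U" "y \<in> ?V - U" for x y
    proof
      assume "{x, y} \<in> edges G - edges H - F"
      hence "(x, y) \<in> r" by (simp add: r_def)
      moreover have "(u, x) \<in> r\<^sup>*" using that(1) by (simp add: U_def)
      ultimately have "(u, y) \<in> r\<^sup>*" by (rule rtrancl_into_rtrancl[rotated])
      thus False using that(2) by (simp add: U_def)
    qed
    obtain S where S: "S \<subseteq> ?V" "S \<noteq> {}" "2 * card S \<le> card ?V"
      and sep: "\<And>x y. x \<in> S \<Longrightarrow> y \<in> ?V - S \<Longrightarrow> {x, y} \<notin> edges G - edges H - F"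
    proof (cases "2 * card U \<le> card ?V")
      case True
      thus thesis using that[of U] U closed by blast
    next
      case False
      have "card (?V - U) = card ?V - card U"
        using U finV by (simp add: card_Diff_subset finite_subset)
      hence "2 * card (?V - U) \<le> card ?V" using False by simp
      moreover have "{x, y} \<notin> edges G - edges H - F" if "x \<in> ?V - U" "y \<in> ?V - (?V - U)" for x y
        using closed[of y x] that by (simp add: insert_commute)
      ultimately show thesis using that[of "?V - U"] U by blast
    qed
    have finS: "finite S" using S(1) finV finite_subset by metis
    have "arcs G S (?V - S) \<subseteq> arcs H S ?V \<union> arcs (?V, F) S (?V - S)"
      using sep by (auto simp: arcs_def)
    hence "card (arcs G S (?V - S)) \<le> card (arcs H S ?V \<union> arcs (?V, F) S (?V - S))"
    proof (rule card_mono[rotated])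
      have "arcs (?V, F) S (?V - S) \<subseteq> S \<times> ?V" by (auto simp: arcs_def)
      hence "finite (arcs (?V, F) S (?V - S))" by (rule finite_subset) (use finS finV in auto)
      thus "finite (arcs H S ?V \<union> arcs (?V, F) S (?V - S))"
        using finite_arcs[OF finS H'(1)] by blast
    qed
    also have "\<dots> \<le> card (arcs H S ?V) + card (arcs (?V, F) S (?V - S))" by (rule card_Un_le)
    also have "card (arcs H S ?V) \<le> D * card S"
    proof -
      have "card (nbrs H x \<inter> ?V) \<le> D" if "x \<in> S" for x
      proof -
        have "card (nbrs H x \<inter> ?V) \<le> card (nbrs H x)"
          by (intro card_mono finite_nbrs H') auto
        also have "\<dots> \<le> D"
          using degree_le_max_degree[of H x] degree_eq_card_nbrs[OF H'(1), of x] D(1) S(1) that H'(2) finV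
          by auto
        finally show ?thesis .
      qed
      hence "(\<Sum>x\<in>S. card (nbrs H x \<inter> ?V)) \<le> (\<Sum>x\<in>S. D)" by (rule sum_mono)
      thus ?thesis using card_arcs[OF H'(1) finS] by (simp add: mult.commute)
    qed
    also have "card (arcs (?V, F) S (?V - S)) \<le> card F"
    proof (rule card_inj_on_le)
      show "inj_on (\<lambda>(x, y). {x, y}) (arcs (?V, F) S (?V - S))"
        by (auto simp: inj_on_def arcs_def doubleton_eq_iff)
      show "(\<lambda>(x, y). {x, y}) ` arcs (?V, F) S (?V - S) \<subseteq> F" by (auto simp: arcs_def)
    qed (fact finF)
    finally have "d + D * (card S - 1) \<le> D * card S + card F" using cut[OF S] by simp
    moreover have "D * card S = D * (card S - 1) + D"
    proof -
      have "card S = (card S - 1) + 1" using S(2) finS by (simp add: Suc_leI card_gt_0_iff)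
      thus ?thesis by (metis distrib_left mult.right_neutral)
    qed
    ultimately show False using F(2) D(2) by linarith
  qed
qed

text \<open>Deleting \<open>d - k + 1\<close> edges at \<open>v\<close> leaves \<open>k - 1\<close>
  edges there, and removing those isolates \<open>v\<close>. Any other vertex meets the star in at
  most one edge.\<close>

lemma not_edge_connected_delete_star:
  assumes G: "simple_graph G" and v: "v \<in> verts G" "degree G v = d" and w: "w \<in> verts G" "w \<noteq> v"
    and k: "1 \<le> k" "k \<le> d"
  obtains H where "spanning_subgraph H G" "max_degree H = d - k + 1"
    "\<not> edge_connected k (delete_edges G (edges H))"
proof -
  define I where "I = {e \<in> edges G. v \<in> e}"
  have finI: "finite I" "card I = d"
    using finite_edges[OF G] v unfolding I_def degree_def by auto
  obtain F where F: "F \<subseteq> I" "card F = d - k + 1"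
    using obtain_subset_with_card_n[of "d - k + 1" I] finI k by force
  have finF: "finite F" using F finI finite_subset by metis
  have dv: "degree (verts G, F) v = d - k + 1"
  proof -
    have "{e \<in> F. v \<in> e} = F" using F by (auto simp: I_def)
    thus ?thesis using F by (simp add: degree_def)
  qed
  have dw: "degree (verts G, F) x \<le> d - k + 1" if "x \<noteq> v" for x
  proof -
    have "{e \<in> F. x \<in> e} \<subseteq> {{v, x}}"
    proof
      fix e assume e: "e \<in> {e \<in> F. x \<in> e}"
      hence "e \<in> edges G" "v \<in> e" using F by (auto simp: I_def)
      then obtain a b where "e = {a, b}" using simple_graph_edgeE[OF G] by metis
      thus "e \<in> {{v, x}}" using e \<open>v \<in> e\<close> that by auto
    qed
    hence "card {e \<in> F. x \<in> e} \<le> card {{v, x}}" by (rule card_mono[rotated]) simp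
    thus ?thesis by (simp add: degree_def)
  qed
  have "max_degree (verts G, F) = d - k + 1"
    unfolding max_degree_def
  proof (rule Max_eqI)
    show "finite (degree (verts G, F) ` verts (verts G, F))"
      using G by (simp add: simple_graph_def)
    show "d - k + 1 \<in> degree (verts G, F) ` verts (verts G, F)" using dv v by force
  qed (use dv dw in force)
  moreover have "spanning_subgraph (verts G, F) G"
    using F by (auto simp: spanning_subgraph_def I_def)
  moreover have "\<not> edge_connected k (delete_edges G (edges (verts G, F)))"
  proof
    assume ec: "edge_connected k (delete_edges G (edges (verts G, F)))"
    have "card (I - F) = d - (d - k + 1)" using F finI finF by (simp add: card_Diff_subset)
    hence "card (I - F) < k" using k by simp
    moreover have "I - F \<subseteq> edges (delete_edges G (edges (verts G, F)))"
      by (auto simp: delete_edges_def I_def)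
    ultimately have "connected_graph (delete_edges (delete_edges G (edges (verts G, F))) (I - F))"
      using ec unfolding edge_connected_def by blast
    hence "(v, w) \<in> {(x, y). {x, y} \<in> edges G - F - (I - F)}\<^sup>*"
      using v w by (auto simp: connected_graph_def delete_edges_def)
    then obtain y where "{v, y} \<in> edges G - F - (I - F)"
      using w(2) by (auto elim: converse_rtranclE)
    thus False by (auto simp: I_def)
  qed
  ultimately show thesis using that by blast
qed

text \<open>Deleting all edges across an internal partition disconnects the graph, so already the
  empty \<open>F\<close> refutes edge connectivity.\<close>

lemma not_edge_connected_delete_cut:
  assumes G: "simple_graph G" and deg: "\<And>v. v \<in> verts G \<Longrightarrow> card (nbrs G v) = d"
    and ne: "verts G \<noteq> {}" and d: "1 \<le> d" and k: "1 \<le> k"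
  obtains H where "spanning_subgraph H G" "2 * max_degree H \<le> d + 2"
    "\<not> edge_connected k (delete_edges G (edges H))"
proof -
  let ?V = "verts G"
  \<comment> \<open>The largest \<open>t\<close> with \<open>2 * t + 1 <= d\<close>. A vertex loses
    at most \<open>d - t\<close> edges, and \<open>2 * (d - t) <= d + 2\<close>.\<close>
  define t where "t = (d - 1) div 2"
  have t: "2 * t + 1 \<le> d" "d \<le> 2 * t + 2" using d by (auto simp: t_def)
  obtain A where A: "inner_degree_ge G t A" "inner_degree_ge G t (?V - A)"
    using internal_partition[OF G ne, of t] deg t by force
  have AV: "A \<subseteq> ?V" "A \<noteq> {}" "?V - A \<noteq> {}" using A by (auto simp: inner_degree_ge_def)
  define F where "F = {e \<in> edges G. e \<inter> A \<noteq> {} \<and> e \<inter> (?V - A) \<noteq> {}}"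
  have H: "simple_graph (?V, F)" using G by (auto simp: simple_graph_def F_def)
  have deg': "degree (?V, F) v \<le> d - t" if v: "v \<in> ?V" for v
  proof -
    obtain X where X: "v \<in> X" "inner_degree_ge G t X" "X = A \<or> X = ?V - A"
    proof (cases "v \<in> A")
      case True
      thus thesis using that[of A] A(1) by simp
    next
      case False
      thus thesis using that[of "?V - A"] A(2) v by simp
    qed
    have "u \<notin> X" if "{v, u} \<in> F" for u
      using X(1,3) that AV(1) unfolding F_def by auto
    hence "nbrs (?V, F) v \<subseteq> nbrs G v - X"
      unfolding nbrs_def F_def by auto
    hence "card (nbrs (?V, F) v) \<le> card (nbrs G v - X)"
      by (rule card_mono[rotated]) (simp add: finite_nbrs[OF G])
    also have "\<dots> = d - card (nbrs G v \<inter> X)"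
      using deg[OF v] finite_nbrs[OF G] by (metis card_Diff_subset_Int finite_Int)
    also have "\<dots> \<le> d - t" using X by (intro diff_le_mono2) (auto simp: inner_degree_ge_def)
    finally show ?thesis using degree_eq_card_nbrs[OF H] by simp
  qed
  have "max_degree (?V, F) \<le> d - t"
    unfolding max_degree_def using deg' ne G by (subst Max_le_iff) (auto simp: simple_graph_def)
  hence "2 * max_degree (?V, F) \<le> d + 2" using t by linarith
  moreover have "spanning_subgraph (?V, F) G" by (auto simp: spanning_subgraph_def F_def)
  moreover have "\<not> edge_connected k (delete_edges G (edges (?V, F)))"
  proof
    assume "edge_connected k (delete_edges G (edges (?V, F)))"
    hence "connected_graph (delete_edges (delete_edges G (edges (?V, F))) {})"
      using k unfolding edge_connected_def by fastforce
    moreover obtain a b where ab: "a \<in> A" "b \<in> ?V - A" using AV by blast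
    ultimately have *: "(a, b) \<in> {(x, y). {x, y} \<in> edges G - F}\<^sup>*"
      using AV by (auto simp: connected_graph_def delete_edges_def)
    have "x \<in> A" if "(a, x) \<in> {(x, y). {x, y} \<in> edges G - F}\<^sup>*" for x
      using that
    proof (induction rule: rtrancl_induct)
      case (step y z)
      hence "z \<in> ?V" "y \<in> A" "{y, z} \<in> edges G" "{y, z} \<notin> F"
        using simple_graph_edgeD(2)[OF G, of y z] by auto
      thus ?case by (auto simp: F_def)
    qed (use ab in auto)
    thus False using * ab by blast
  qed
  ultimately show thesis using that by blast
qed

definition expanding :: "nat \<Rightarrow> nat \<Rightarrow> nat sgraph \<Rightarrow> bool" where
  "expanding d n G \<longleftrightarrow> (\<forall>S \<subseteq> {1..n}. \<forall>D :: nat. S \<noteq> {} \<longrightarrow> 2 * card S \<le> n \<longrightarrow>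
     real D \<le> real d / 2 - sqrt (real d) \<longrightarrow> d + D * (card S - 1) \<le> card (arcs G S ({1..n} - S)))"

text \<open>\<open>LEAST\<close> is informative only if its predicate can be satisfied; one witness
  gives both an upper bound and a minimiser.\<close>

lemma local_resilience_witness:
  assumes "spanning_subgraph H G" "\<not> P (delete_edges G (edges H))"
  shows "local_resilience G P \<le> max_degree H"
    and "\<exists>H. spanning_subgraph H G \<and> max_degree H = local_resilience G P \<and> \<not> P (delete_edges G (edges H))"
proof -
  let ?Q = "\<lambda>r. \<exists>H. spanning_subgraph H G \<and> max_degree H = r \<and> \<not> P (delete_edges G (edges H))"
  have Q: "?Q (max_degree H)" using assms by blast
  show "local_resilience G P \<le> max_degree H"
    unfolding local_resilience_def using Q by (rule Least_le)
  show "?Q (local_resilience G P)"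
    unfolding local_resilience_def using Q by (rule LeastI)
qed

text \<open>The star and the partition give the upper bounds. If both alternatives of the last claim
  failed, the resilience itself would be an admissible \<open>D\<close> with
  \<open>k + D <= d\<close>, and a minimiser could not destroy edge connectivity.\<close>

lemma local_resilience_expanding:
  assumes d: "d \<ge> 3" and n: "n \<ge> 2" and G: "G \<in> regular_graphs d n" and ex: "expanding d n G"
    and k: "1 \<le> k" "k \<le> d"
  shows "local_resilience G (edge_connected k) \<le> d - k + 1"
    and "real (local_resilience G (edge_connected k)) \<le> real d / 2 + 4 * sqrt (real d * ln (real d))"
    and "real (local_resilience G (edge_connected k)) > real d / 2 - sqrt (real d)
      \<or> local_resilience G (edge_connected k) > d - k"
proof -
  note R = regular_graphsD[OF G]
  let ?r = "local_resilience G (edge_connected k)"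
  have deg1: "degree G 1 = d" using G n by (auto simp: regular_graphs_def)
  have V: "1 \<in> verts G" "2 \<in> verts G" "(2 :: nat) \<noteq> 1" "verts G \<noteq> {}" using R(2) n by auto
  obtain H where H: "spanning_subgraph H G" "max_degree H = d - k + 1"
      "\<not> edge_connected k (delete_edges G (edges H))"
    using not_edge_connected_delete_star[OF R(1) V(1) deg1 V(2,3) k] .
  show "?r \<le> d - k + 1" using local_resilience_witness(1)[of H G "edge_connected k", OF H(1,3)] H(2) by simp
  obtain H' where H': "spanning_subgraph H' G" "2 * max_degree H' \<le> d + 2"
      "\<not> edge_connected k (delete_edges G (edges H'))"
    using not_edge_connected_delete_cut[OF R(1) R(3) V(4) _ k(1)] R(2) d by auto
  have "2 * ?r \<le> d + 2" using local_resilience_witness(1)[of H' G "edge_connected k", OF H'(1,3)] H'(2) by linarith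
  hence "2 * real ?r \<le> real d + 2" by linarith
  \<comment> \<open>The partition gives \<open>d / 2 + 1\<close>, so it suffices that
    \<open>d * ln d >= 1\<close>, which follows from \<open>exp 1 < 3\<close>.\<close>
  moreover have "1 \<le> sqrt (real d * ln (real d))"
  proof -
    have "ln (real d) \<ge> ln 3" using d by simp
    moreover have "ln (3 :: real) \<ge> 1" using e_less_272 by (subst ln_ge_iff) auto
    ultimately have "1 \<le> ln (real d)" by linarith
    hence "1 * 1 \<le> real d * ln (real d)" using d by (intro mult_mono) auto
    thus ?thesis by simp
  qed
  ultimately show "real ?r \<le> real d / 2 + 4 * sqrt (real d * ln (real d))" by linarith
  obtain K where K: "spanning_subgraph K G" "max_degree K = ?r"
      "\<not> edge_connected k (delete_edges G (edges K))"
    using local_resilience_witness(2)[of H G "edge_connected k", OF H(1,3)] by blast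
  show "real ?r > real d / 2 - sqrt (real d) \<or> ?r > d - k"
  proof (rule ccontr)
    assume "\<not> ?thesis"
    hence r: "real ?r \<le> real d / 2 - sqrt (real d)" "k + ?r \<le> d" using k by auto
    have "edge_connected k (delete_edges G (edges K))"
    proof (rule edge_connected_delete_edges[OF R(1) _ K(1) _ r(2)])
      show "d + ?r * (card S - 1) \<le> card (arcs G S (verts G - S))"
        if "S \<subseteq> verts G" "S \<noteq> {}" "2 * card S \<le> card (verts G)" for S
        using ex that r(1) unfolding expanding_def R(2) by simp
    qed (use n R K in auto)
    thus False using K(3) by blast
  qed
qed

text \<open>At \<open>k = d / 2 + sqrt d\<close> the quantity \<open>d - k\<close> crosses
  \<open>d / 2 - sqrt d\<close>. On each side of this threshold both alternatives of the previous
  lower bound imply the wanted one.\<close>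

lemma resilience_bounds_if_expanding:
  assumes d: "d \<ge> 3" and n: "n \<ge> 2" and G: "G \<in> regular_graphs d n" and ex: "expanding d n G"
  shows "(\<forall>k::nat. real d / 2 + sqrt (real d) \<le> real k \<and> k \<le> d \<longrightarrow>
            local_resilience G (edge_connected k) = d - k + 1)"
    and "(\<forall>k::nat. 1 \<le> k \<and> real k < real d / 2 + sqrt (real d) \<longrightarrow>
            real d / 2 - sqrt (real d) < real (local_resilience G (edge_connected k)) \<and>
            real (local_resilience G (edge_connected k))
              \<le> min (real d - real k + 1) (real d / 2 + 4 * sqrt (real d * ln (real d))))"
proof safe
  note * = local_resilience_expanding[OF assms]
  fix k assume k: "real d / 2 + sqrt (real d) \<le> real k" "k \<le> d"
  have "0 < real d / 2 + sqrt (real d)" using d by (intro add_pos_nonneg) auto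
  hence k1: "1 \<le> k" using k(1) by linarith
  have "real (d - k) \<le> real d / 2 - sqrt (real d)" using k by (simp add: of_nat_diff)
  hence "local_resilience G (edge_connected k) > d - k" using *(3)[OF k1 k(2)] by auto
  thus "local_resilience G (edge_connected k) = d - k + 1" using *(1)[OF k1 k(2)] by simp
next
  note * = local_resilience_expanding[OF assms]
  fix k :: nat assume k: "1 \<le> k" "real k < real d / 2 + sqrt (real d)"
  \<comment> \<open>For \<open>d >= 4\<close> one has \<open>sqrt d <= d / 2\<close>. For
    \<open>d = 3\<close> this fails, but \<open>3 / 2 + sqrt 3 < 4\<close> suffices for an integer
    \<open>k\<close>.\<close>
  have kd: "k \<le> d"
  proof (cases "d = 3")
    case True
    have "sqrt 3 < (2 :: real)" by (rule real_less_lsqrt) auto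
    thus ?thesis using k True by simp
  next
    case False
    hence "sqrt (real d) * 2 \<le> sqrt (real d) * sqrt (real d)"
      using d by (intro mult_left_mono real_le_rsqrt) auto
    thus ?thesis using k by simp
  qed
  show "real d / 2 - sqrt (real d) < real (local_resilience G (edge_connected k))"
  proof (rule ccontr)
    assume "\<not> ?thesis"
    with *(3)[OF k(1) kd] have "d - k < local_resilience G (edge_connected k)" by simp
    hence "real d - real k < real (local_resilience G (edge_connected k))" using kd by linarith
    thus False using \<open>\<not> _\<close> k by linarith
  qed
  show "real (local_resilience G (edge_connected k))
     \<le> min (real d - real k + 1) (real d / 2 + 4 * sqrt (real d * ln (real d)))"
    using *(1,2)[OF k(1) kd] kd by (simp add: of_nat_diff)
qed

section \<open>Existence of regular graphs\<close>

text \<open>These are connection sets of circulant graphs. For odd \<open>d\<close> the order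
  \<open>n\<close> is even, and the self-paired difference \<open>n / 2\<close> supplies the odd
  element.\<close>

lemma symmetric_differences:
  assumes "d < n" "even (d * n)"
  obtains D :: "int set" where "D \<subseteq> {1..<int n}" "card D = d" "\<And>x. x \<in> D \<Longrightarrow> int n - x \<in> D"
proof (cases "even d")
  case True
  then obtain m where m: "d = 2 * m" by auto
  let ?D = "{1..int m} \<union> {int n - int m..<int n}"
  have "card ?D = card {1..int m} + card {int n - int m..<int n}"
    using assms m by (intro card_Un_disjoint) auto
  hence "card ?D = d" using m by simp
  moreover have "?D \<subseteq> {1..<int n}" using assms m by auto
  moreover have "int n - x \<in> ?D" if "x \<in> ?D" for x using that by auto
  ultimately show thesis using that by blast
next
  case False
  then obtain m where m: "d = 2 * m + 1" by (auto elim: oddE)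
  obtain k where k: "n = 2 * k" using assms False by auto
  have mk: "m < k" using assms m k by simp
  let ?D = "insert (int k) ({1..int m} \<union> {int n - int m..<int n})"
  have "card ({1..int m} \<union> {int n - int m..<int n}) = card {1..int m} + card {int n - int m..<int n}"
    using mk k by (intro card_Un_disjoint) auto
  moreover have "int k \<notin> {1..int m} \<union> {int n - int m..<int n}" using mk k by auto
  ultimately have "card ?D = d" using m by simp
  moreover have "?D \<subseteq> {1..<int n}" using mk k by auto
  moreover have "int n - x \<in> ?D" if "x \<in> ?D" for x using that k by auto
  ultimately show thesis using that by blast
qed

text \<open>In the circulant graph, differences from a fixed \<open>i\<close> run once through all
  residues modulo \<open>n\<close>, so the degree is \<open>card D\<close>. Nonemptiness makes
  \<open>pmf_of_set\<close> the uniform distribution.\<close>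

lemma regular_graphs_nonempty:
  assumes "d < n" "even (d * n)"
  shows "regular_graphs d n \<noteq> {}"
proof -
  obtain D :: "int set" where D: "D \<subseteq> {1..<int n}" "card D = d" "\<And>x. x \<in> D \<Longrightarrow> int n - x \<in> D"
    using symmetric_differences[OF assms] by blast
  define r where "r = (\<lambda>i j. (int j - int i) mod int n)"
  define E where "E = {{i, j} | i j. i \<in> {1..n} \<and> j \<in> {1..n} \<and> r i j \<in> D}"
  let ?G = "({1..n}, E)"
  have n: "0 < int n" using assms by simp
  have zero: "0 \<notin> D" using D(1) by auto
  have sym: "r j i \<in> D" if "r i j \<in> D" for i j
  proof -
    have "r j i = (- (int j - int i)) mod int n" by (simp add: r_def)
    also have "\<dots> = int n - r i j"
      using that zero n by (simp only: zmod_zminus1_eq_if r_def split: if_splits) auto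
    finally show ?thesis using D(3)[OF that] by simp
  qed
  have simple: "simple_graph ?G"
    using zero by (auto simp: simple_graph_def E_def nsets_def r_def card_insert_if)
  have "degree ?G i = d" if i: "i \<in> {1..n}" for i
  proof -
    have nbrs: "nbrs ?G i = {j \<in> {1..n}. r i j \<in> D}"
    proof (intro equalityI subsetI)
      fix j assume "j \<in> nbrs ?G i"
      then obtain a b where "{i, j} = {a, b}" "a \<in> {1..n}" "b \<in> {1..n}" "r a b \<in> D"
        by (auto simp: nbrs_def E_def)
      thus "j \<in> {j \<in> {1..n}. r i j \<in> D}" using sym by (auto simp: doubleton_eq_iff)
    next
      fix j assume "j \<in> {j \<in> {1..n}. r i j \<in> D}"
      thus "j \<in> nbrs ?G i" using i by (auto simp: nbrs_def E_def)
    qed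
    have inj: "inj_on (r i) {1..n}"
    proof (rule inj_onI)
      fix j k assume jk: "j \<in> {1..n}" "k \<in> {1..n}" and "r i j = r i k"
      hence "int n dvd (int j - int i) - (int k - int i)" unfolding r_def by (simp only: mod_eq_dvd_iff)
      hence "int n dvd int j - int k" by simp
      moreover have "\<bar>int j - int k\<bar> < int n" using jk by auto
      ultimately have "int j - int k = 0" by (metis dvd_imp_le_int not_le abs_of_nat)
      thus "j = k" by simp
    qed
    have "r i ` {1..n} \<subseteq> {0..<int n}" using n by (auto simp: r_def)
    moreover have "card (r i ` {1..n}) = card {0..<int n}" using card_image[OF inj] by simp
    ultimately have surj: "r i ` {1..n} = {0..<int n}" by (intro card_subset_eq) auto
    have "r i ` nbrs ?G i = D"
    proof
      show "r i ` nbrs ?G i \<subseteq> D" unfolding nbrs by auto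
      show "D \<subseteq> r i ` nbrs ?G i"
      proof
        fix x assume x: "x \<in> D"
        hence "x \<in> r i ` {1..n}" using D(1) unfolding surj by auto
        thus "x \<in> r i ` nbrs ?G i" using x unfolding nbrs by auto
      qed
    qed
    moreover have "inj_on (r i) (nbrs ?G i)" using inj by (rule inj_on_subset) (unfold nbrs, blast)
    ultimately show ?thesis using D(2) degree_eq_card_nbrs[OF simple] by (metis card_image)
  qed
  hence "?G \<in> regular_graphs d n" using simple by (simp add: regular_graphs_def)
  thus ?thesis by blast
qed

section \<open>Iterating the switching inequality\<close>

definition phi :: "real \<Rightarrow> real \<Rightarrow> real \<Rightarrow> real" where
  "phi a b y = ln (a - y) + ln (b - y) - 2 * ln y"

text \<open>
  \<open>phi\<close> is the logarithmic gain of one switching at cut size \<open>y\<close> when the two sides have total degrees \<open>a\<close>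
  and \<open>b\<close>, and \<open>psi\<close> is an antiderivative of it. A switching raises the cut size by 2, whence the
  factor 1/2 in front of \<open>psi\<close> below.
\<close>

definition psi :: "real \<Rightarrow> real \<Rightarrow> real \<Rightarrow> real" where
  "psi a b y = - (a - y) * ln (a - y) - (b - y) * ln (b - y) - 2 * y * ln y"

lemma psi_has_derivative:
  assumes "0 < y" "y < a" "y < b"
  shows "(psi a b has_real_derivative phi a b y) (at y)"
  unfolding psi_def[abs_def] phi_def
  using assms by (auto intro!: derivative_eq_intros simp: divide_simps) (simp add: algebra_simps)

lemma phi_antimono:
  assumes "0 < u" "u \<le> v" "v < a" "v < b"
  shows "phi a b v \<le> phi a b u"
proof -
  have "ln (a - v) \<le> ln (a - u)" "ln (b - v) \<le> ln (b - u)" "ln u \<le> ln v" using assms by auto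
  thus ?thesis unfolding phi_def by linarith
qed

text \<open>The point \<open>a * b / (a + b)\<close> solves
  \<open>(a - y) * (b - y) = y * y\<close>, so \<open>phi\<close> vanishes there; it is the typical
  cut size.\<close>

lemma equilibrium_less:
  fixes a b :: real
  assumes "0 < a" "0 < b"
  shows "a * b / (a + b) < a" "a * b / (a + b) < b"
  using assms by (auto simp: divide_less_eq algebra_simps)

lemma phi_nonneg:
  assumes "0 < y" "y \<le> a * b / (a + b)" "0 < a" "0 < b"
  shows "0 \<le> phi a b y"
proof -
  have ya: "y < a" "y < b" using assms equilibrium_less[of a b] by linarith+
  have "y * (a + b) \<le> a * b" using assms by (simp add: pos_le_divide_eq)
  hence "y * y \<le> (a - y) * (b - y)" by (simp add: algebra_simps)
  hence "ln (y * y) \<le> ln ((a - y) * (b - y))" using assms(1) by (intro ln_mono) auto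
  thus ?thesis using assms(1) ya by (simp add: phi_def ln_mult)
qed

text \<open>Mean value theorem: \<open>phi\<close> is decreasing, and nonnegative up to the
  equilibrium.\<close>

lemma psi_diff:
  assumes "0 < u" "u \<le> v" "v \<le> a * b / (a + b)" "0 < a" "0 < b"
  shows "psi a b v - psi a b u \<le> (v - u) * phi a b u" and "psi a b u \<le> psi a b v"
proof -
  have va: "v < a" "v < b" using assms equilibrium_less[of a b] by linarith+
  have "psi a b v - psi a b u \<le> (v - u) * phi a b u \<and> psi a b u \<le> psi a b v"
  proof (cases "u = v")
    case False
    hence uv: "u < v" using assms by simp
    obtain z where z: "u < z" "z < v" "psi a b v - psi a b u = (v - u) * phi a b z"
      using MVT2[OF uv, of "psi a b" "phi a b"] psi_has_derivative assms va by force
    have "phi a b z \<le> phi a b u" using phi_antimono z assms va by auto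
    moreover have "0 \<le> phi a b z" using phi_nonneg z assms by auto
    ultimately show ?thesis using z uv by (smt (verit) mult_left_mono mult_nonneg_nonneg)
  qed simp
  thus "psi a b v - psi a b u \<le> (v - u) * phi a b u" "psi a b u \<le> psi a b v" by auto
qed

lemma equilibrium_le_quarter:
  fixes a b :: real
  assumes "0 < a" "0 < b"
  shows "a * b / (a + b) \<le> (a + b) / 4"
proof -
  have "0 \<le> (a - b)\<^sup>2" by simp
  hence "a * b \<le> (a + b) / 4 * (a + b)" by (simp add: power2_eq_square algebra_simps)
  thus ?thesis using assms by (simp add: pos_divide_le_eq)
qed

lemma one_minus_ge_exp:
  fixes u :: real
  assumes "0 \<le> u" "u \<le> 1 / 2"
  shows "exp (- 2 * u) \<le> 1 - u"
proof -
  have "u * u \<le> u * (1/2)" using assms by (intro mult_left_mono) auto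
  hence "1 \<le> (1 - u) * (1 + 2 * u)" by (simp add: algebra_simps)
  also have "\<dots> \<le> (1 - u) * exp (2 * u)"
    using assms exp_ge_add_one_self[of "2 * u"] by (intro mult_left_mono) auto
  finally show ?thesis by (simp add: exp_minus divide_simps)
qed

text \<open>Rounding the factors to \<open>y = k + 2\<close> gives the ratio
  \<open>exp (- phi a b y)\<close>. As \<open>b - y >= (a + b) / 4\<close>, the loss
  \<open>c\<close> is at most the fraction \<open>4 * c / (a + b)\<close> of \<open>b - y\<close>,
  hence the factor \<open>exp (8 * c / (a + b))\<close>.\<close>

lemma switching_step:
  fixes p p' k a b c :: real
  assumes p: "0 \<le> p" "0 \<le> p'" and k: "0 \<le> k"
    and step: "p * ((a - k) * (b - k - c)) \<le> p' * ((k + 2) * (k + 1))"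
    and ab: "0 < a" "a \<le> b" "0 \<le> c" "8 * c \<le> a + b" and y: "k + 2 \<le> a * b / (a + b)"
  shows "p \<le> exp (8 * c / (a + b) - phi a b (k + 2)) * p'"
proof -
  define y where "y = k + 2"
  define \<delta> where "\<delta> = 8 * c / (a + b)"
  have y0: "0 < y" "y \<le> a * b / (a + b)" using k assms(9) by (auto simp: y_def)
  have ya: "y < a" "y < b" using y0 equilibrium_less[of a b] ab by linarith+
  have quarter: "(a + b) / 4 \<le> b - y"
  proof -
    have "a * b / (a + b) \<le> (a + b) / 4" using ab by (intro equilibrium_le_quarter) auto
    with y0(2) have "y \<le> (a + b) / 4" by (rule order_trans)
    hence "4 * y \<le> a + b" by simp
    hence "a + b \<le> 4 * (b - y)" using ab(2) by simp
    thus ?thesis by simp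
  qed
  have u: "0 \<le> 4 * c / (a + b)" "4 * c / (a + b) \<le> 1 / 2" using ab by (auto simp: divide_simps)
  have "(b - y) * exp (- \<delta>) \<le> (b - y) * (1 - 4 * c / (a + b))"
    using one_minus_ge_exp[OF u] ya by (intro mult_left_mono) (auto simp: \<delta>_def)
  also have "\<dots> \<le> b - y - c"
  proof -
    have "(a + b) / 4 * (4 * c / (a + b)) \<le> (b - y) * (4 * c / (a + b))"
      using quarter u by (intro mult_right_mono)
    moreover have "(a + b) / 4 * (4 * c / (a + b)) = c" using ab by simp
    ultimately show ?thesis by (simp add: right_diff_distrib)
  qed
  also have "\<dots> \<le> b - k - c" by (simp add: y_def)
  finally have B: "(b - y) * exp (- \<delta>) \<le> b - k - c" .
  have "p * ((a - y) * ((b - y) * exp (- \<delta>))) \<le> p * ((a - k) * (b - k - c))"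
    using p B ya by (intro mult_left_mono mult_mono) (auto simp: y_def)
  also have "\<dots> \<le> p' * ((k + 2) * (k + 1))" by (rule step)
  also have "\<dots> \<le> p' * (y * y)" using p k by (intro mult_left_mono mult_mono) (auto simp: y_def)
  finally have "p * ((a - y) * (b - y)) \<le> exp \<delta> * (p' * (y * y))"
    by (simp add: exp_minus field_simps)
  hence "p \<le> exp \<delta> * (p' * (y * y)) / ((a - y) * (b - y))"
    using ya by (simp add: pos_le_divide_eq)
  also have "\<dots> = exp \<delta> * (y * y / ((a - y) * (b - y))) * p'" by simp
  also have "y * y / ((a - y) * (b - y)) = exp (- phi a b y)"
    using y0 ya by (simp add: phi_def exp_add exp_diff exp_minus power2_eq_square exp_double)
  also have "exp \<delta> * exp (- phi a b y) = exp (\<delta> - phi a b y)" by (simp flip: exp_add)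
  finally show ?thesis by (simp only: y_def \<delta>_def)
qed

text \<open>As \<open>phi\<close> decreases, its values at steps of length two dominate half its
  integral, so the product of the ratios is bounded by a difference of \<open>psi\<close>. There are
  at most \<open>(z - real k) / 2\<close> steps, each costing
  \<open>8 * c / (a + b)\<close>.\<close>

lemma switching_telescope:
  fixes p :: "nat \<Rightarrow> real" and a b c :: real
  assumes p: "\<And>k. 0 \<le> p k" "\<And>k. p k \<le> 1"
    and step: "\<And>k. p k * ((a - real k) * (b - real k - c)) \<le> p (k + 2) * (real (k + 2) * real (k + 1))"
    and ab: "0 < a" "a \<le> b" "0 \<le> c" "8 * c \<le> a + b"
  defines "z \<equiv> a * b / (a + b)"
  shows "real k + 2 \<le> z \<Longrightarrow>
    p k \<le> exp ((psi a b (real k + 2) - psi a b z) / 2 + 8 * c / (a + b) * ((z - real k) / 2))"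
proof (induction "nat \<lfloor>z\<rfloor> - k" arbitrary: k rule: less_induct)
  case less
  define \<delta> where "\<delta> = 8 * c / (a + b)"
  have \<delta>: "0 \<le> \<delta>" using ab by (simp add: \<delta>_def)
  have b: "0 < b" using ab by simp
  have st: "p k \<le> exp (\<delta> - phi a b (real k + 2)) * p (k + 2)"
    unfolding \<delta>_def
  proof (rule switching_step)
    show "p k * ((a - real k) * (b - real k - c)) \<le> p (k + 2) * ((real k + 2) * (real k + 1))"
      using step[of k] by (simp add: add.commute)
  qed (use p ab less.prems in \<open>auto simp: z_def\<close>)
  show ?case
  proof (cases "real k + 4 \<le> z")
    case True
    have "nat \<lfloor>z\<rfloor> - (k + 2) < nat \<lfloor>z\<rfloor> - k" using less.prems by linarith
    hence "p (k + 2) \<le> exp ((psi a b (real k + 4) - psi a b z) / 2 + \<delta> * ((z - real (k + 2)) / 2))"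
      using less.hyps[of "k + 2"] True by (simp add: \<delta>_def add.commute)
    hence "p k \<le> exp (\<delta> - phi a b (real k + 2)) *
        exp ((psi a b (real k + 4) - psi a b z) / 2 + \<delta> * ((z - real (k + 2)) / 2))"
      using st by (meson exp_ge_zero mult_left_mono order_trans)
    also have "\<dots> = exp (\<delta> - phi a b (real k + 2) + ((psi a b (real k + 4) - psi a b z) / 2
        + \<delta> * ((z - real (k + 2)) / 2)))" by (simp only: exp_add)
    also have "\<dots> \<le> exp ((psi a b (real k + 2) - psi a b z) / 2 + \<delta> * ((z - real k) / 2))"
    proof (subst exp_le_cancel_iff)
      have "psi a b (real k + 4) - psi a b (real k + 2) \<le> 2 * phi a b (real k + 2)"
        using psi_diff(1)[of "real k + 2" "real k + 4" a b] True ab b by (simp add: z_def)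
      thus "\<delta> - phi a b (real k + 2) + ((psi a b (real k + 4) - psi a b z) / 2
        + \<delta> * ((z - real (k + 2)) / 2)) \<le> (psi a b (real k + 2) - psi a b z) / 2 + \<delta> * ((z - real k) / 2)"
        by (simp add: field_simps)
    qed
    finally show ?thesis by (simp only: \<delta>_def)
  next
    case False
    \<comment> \<open>Last step: \<open>p (k + 2)\<close> is bounded by 1, and the remaining
      \<open>psi\<close> difference spans less than two units.\<close>
    have ph: "0 \<le> phi a b (real k + 2)" using phi_nonneg less.prems ab b by (auto simp: z_def)
    have "p k \<le> exp (\<delta> - phi a b (real k + 2)) * 1"
      using st p(2)[of "k + 2"] by (meson exp_ge_zero mult_left_mono order_trans)
    also have "\<dots> \<le> exp ((psi a b (real k + 2) - psi a b z) / 2 + \<delta> * ((z - real k) / 2))"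
    proof -
      have "psi a b z - psi a b (real k + 2) \<le> (z - (real k + 2)) * phi a b (real k + 2)"
        using psi_diff(1)[of "real k + 2" z a b] less.prems ab b by (simp add: z_def)
      also have "\<dots> \<le> 2 * phi a b (real k + 2)" using False ph by (intro mult_right_mono) auto
      finally have "- phi a b (real k + 2) \<le> (psi a b (real k + 2) - psi a b z) / 2" by simp
      moreover have "\<delta> * 1 \<le> \<delta> * ((z - real k) / 2)"
        using less.prems \<delta> by (intro mult_left_mono) auto
      ultimately have "- phi a b (real k + 2) + \<delta> * 1
          \<le> (psi a b (real k + 2) - psi a b z) / 2 + \<delta> * ((z - real k) / 2)"
        by (rule add_mono)
      thus ?thesis by (simp add: add.commute)
    qed
    finally show ?thesis by (simp only: \<delta>_def)
  qed
qed

text \<open>The equilibrium is at most \<open>(a + b) / 4\<close>, so the accumulated error is at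
  most \<open>c\<close>, however many steps are made.\<close>

lemma switching_bound:
  fixes p :: "nat \<Rightarrow> real" and a b c :: real
  assumes p: "\<And>k. 0 \<le> p k" "\<And>k. p k \<le> 1"
    and step: "\<And>k. p k * ((a - real k) * (b - real k - c)) \<le> p (k + 2) * (real (k + 2) * real (k + 1))"
    and ab: "0 < a" "a \<le> b" "0 \<le> c" "8 * c \<le> a + b"
    and k: "real k + 2 \<le> y" "y \<le> a * b / (a + b)"
  shows "p k \<le> exp ((psi a b y - psi a b (a * b / (a + b))) / 2 + c)"
proof -
  let ?z = "a * b / (a + b)"
  have "p k \<le> exp ((psi a b (real k + 2) - psi a b ?z) / 2 + 8 * c / (a + b) * ((?z - real k) / 2))"
    using k by (intro switching_telescope assms) auto
  also have "\<dots> \<le> exp ((psi a b y - psi a b ?z) / 2 + c)"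
  proof (subst exp_le_cancel_iff, rule add_mono)
    show "(psi a b (real k + 2) - psi a b ?z) / 2 \<le> (psi a b y - psi a b ?z) / 2"
      using psi_diff(2)[of "real k + 2" y a b] k ab by simp
    have "8 * c / (a + b) * ((?z - real k) / 2) \<le> 8 * c / (a + b) * ((a + b) / 8)"
    proof (rule mult_left_mono)
      have "?z \<le> (a + b) / 4" using equilibrium_le_quarter[of a b] ab by simp
      hence "?z - real k \<le> (a + b) / 4" by (rule order_trans[rotated]) simp
      hence "(?z - real k) / 2 \<le> (a + b) / 4 / 2" by (intro divide_right_mono) auto
      thus "(?z - real k) / 2 \<le> (a + b) / 8" by simp
    qed (use ab in simp)
    also have "\<dots> = c" using ab by simp
    finally show "8 * c / (a + b) * ((?z - real k) / 2) \<le> c" .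
  qed
  finally show ?thesis .
qed

section \<open>Comparison with the binomial entropy\<close>

text \<open>
  For \<open>S\<close> of size \<open>\<alpha> n\<close> and cut size \<open>x d (card S)\<close>, \<open>\<alpha> * cut_rate x \<alpha>\<close> is the
  Kullback--Leibler divergence of the edge-type distribution \<open>(\<alpha>(1 - x), 2\<alpha>x, 1 - \<alpha>(1 + x))\<close>
  from \<open>(\<alpha>\<^sup>2, 2\<alpha>(1 - \<alpha>), (1 - \<alpha>)\<^sup>2)\<close>; the probability decays like
  \<open>exp (- (d / 2) * (card S) * cut_rate x \<alpha>)\<close>.
\<close>

definition cut_rate :: "real \<Rightarrow> real \<Rightarrow> real" where
  "cut_rate x \<alpha> = (1 - x) * ln (1 - x) + 2 * x * ln x - (1 - x) * ln \<alpha> + 2 * ln (1 - \<alpha>)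
     + (1 / \<alpha> - (1 + x)) * ln (1 - \<alpha> * (1 + x)) - 2 / \<alpha> * ln (1 - \<alpha>)"

text \<open>Binary entropy of \<open>\<alpha>\<close> with natural logarithms, divided by
  \<open>\<alpha>\<close>.\<close>

definition entropy_rate :: "real \<Rightarrow> real" where
  "entropy_rate \<alpha> = - ln \<alpha> - (1 / \<alpha> - 1) * ln (1 - \<alpha>)"

text \<open>After the division by \<open>\<alpha>\<close> all rational terms of the derivative
  cancel, and only logarithms over the square of \<open>\<alpha>\<close> remain.\<close>

lemma cut_rate_has_derivative:
  assumes "0 < \<alpha>" "\<alpha> < 1" "\<alpha> * (1 + x) < 1"
  shows "(cut_rate x has_real_derivative (2 * ln (1 - \<alpha>) - ln (1 - \<alpha> * (1 + x))) / \<alpha>\<^sup>2) (at \<alpha>)"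
proof -
  have 1: "((\<lambda>\<alpha>. ln (1 - \<alpha> * (1 + x))) has_real_derivative - (1 + x) / (1 - \<alpha> * (1 + x))) (at \<alpha>)"
    using assms by (auto intro!: derivative_eq_intros)
  have 2: "((\<lambda>\<alpha>. 1 / \<alpha>) has_real_derivative - 1 / \<alpha>\<^sup>2) (at \<alpha>)"
    using assms by (auto intro!: derivative_eq_intros simp: power2_eq_square)
  have 3: "((\<lambda>\<alpha>. ln (1 - \<alpha>)) has_real_derivative - 1 / (1 - \<alpha>)) (at \<alpha>)"
    using assms by (auto intro!: derivative_eq_intros)
  have 4: "((\<lambda>\<alpha>. ln \<alpha>) has_real_derivative 1 / \<alpha>) (at \<alpha>)"
    using assms by (auto intro!: derivative_eq_intros)
  have eq: "cut_rate x = (\<lambda>\<alpha>. ((1 - x) * ln (1 - x) + 2 * x * ln x) - (1 - x) * ln \<alpha> + 2 * ln (1 - \<alpha>)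
     + (1 / \<alpha> - (1 + x)) * ln (1 - \<alpha> * (1 + x)) - 2 * (1 / \<alpha> * ln (1 - \<alpha>)))"
    by (auto simp: cut_rate_def)
  define D where "D = 0 - (1 - x) * (1 / \<alpha>) + 2 * (- 1 / (1 - \<alpha>))
     + ((- 1 / \<alpha>\<^sup>2 - 0) * ln (1 - \<alpha> * (1 + x)) + (- (1 + x) / (1 - \<alpha> * (1 + x))) * (1 / \<alpha> - (1 + x)))
     - 2 * (- 1 / \<alpha>\<^sup>2 * ln (1 - \<alpha>) + (- 1 / (1 - \<alpha>)) * (1 / \<alpha>))"
  have "(cut_rate x has_real_derivative D) (at \<alpha>)"
    unfolding eq D_def
    by (intro DERIV_add DERIV_diff DERIV_mult DERIV_const DERIV_cmult 1 2 3 4)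
  also have "D = (2 * ln (1 - \<alpha>) - ln (1 - \<alpha> * (1 + x))) / \<alpha>\<^sup>2"
  proof -
    define w where "w = 1 - \<alpha> * (1 + x)"
    have w: "0 < w" using assms by (simp add: w_def)
    have "1 / \<alpha> - (1 + x) = w / \<alpha>" using assms by (simp add: w_def field_simps)
    hence T: "- (1 + x) / w * (1 / \<alpha> - (1 + x)) = - (1 + x) / \<alpha>" using w by simp
    hence "D = - (1 - x) / \<alpha> - 2 / (1 - \<alpha>) - ln w / \<alpha>\<^sup>2 - (1 + x) / \<alpha> + 2 * ln (1 - \<alpha>) / \<alpha>\<^sup>2
       + 2 / ((1 - \<alpha>) * \<alpha>)"
      unfolding D_def w_def[symmetric] T by (simp add: algebra_simps add_divide_distrib diff_divide_distrib)
    moreover have "- (1 - x) / \<alpha> - 2 / (1 - \<alpha>) - (1 + x) / \<alpha> + 2 / ((1 - \<alpha>) * \<alpha>) = 0"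
      using assms by (simp add: divide_simps) (simp add: algebra_simps)
    ultimately show ?thesis unfolding w_def by (simp add: diff_divide_distrib)
  qed
  finally show ?thesis .
qed

lemma entropy_rate_has_derivative:
  assumes "0 < \<alpha>" "\<alpha> < 1"
  shows "(entropy_rate has_real_derivative ln (1 - \<alpha>) / \<alpha>\<^sup>2) (at \<alpha>)"
proof -
  have "(entropy_rate has_real_derivative
     - (1 / \<alpha>) - ((- 1 / \<alpha>\<^sup>2) * ln (1 - \<alpha>) + (- 1 / (1 - \<alpha>)) * (1 / \<alpha> - 1))) (at \<alpha>)"
    unfolding entropy_rate_def[abs_def] using assms
    by (auto intro!: derivative_eq_intros simp: power2_eq_square)
  also have "- (1 / \<alpha>) - ((- 1 / \<alpha>\<^sup>2) * ln (1 - \<alpha>) + (- 1 / (1 - \<alpha>)) * (1 / \<alpha> - 1)) = ln (1 - \<alpha>) / \<alpha>\<^sup>2"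
  proof -
    have "1 / (1 - \<alpha>) * (1 / \<alpha> - 1) = 1 / \<alpha>" using assms by (simp add: divide_simps)
    thus ?thesis by simp
  qed
  finally show ?thesis .
qed

section \<open>Positivity of the exponent gap\<close>

lemma two_powr_le:
  fixes t :: real
  assumes "0 \<le> t" "t \<le> 1"
  shows "2 powr t \<le> 1 + t"
proof -
  have "exp ((1 - t) *\<^sub>R 0 + t *\<^sub>R ln 2) \<le> (1 - t) * exp 0 + t * exp (ln 2 :: real)"
    using assms by (intro convex_onD[OF exp_convex]) auto
  thus ?thesis by (simp add: powr_def)
qed

text \<open>Pinsker's inequality for Bernoulli parameters \<open>1/2 + h\<close> and
  \<open>1/2\<close>. The difference of the two sides and its derivative vanish at 0, and its second
  derivative is nonnegative.\<close>

lemma binary_pinsker: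
  fixes h :: real
  assumes "0 \<le> h" "h < 1 / 2"
  shows "2 * h\<^sup>2 \<le> (1/2 + h) * ln (1 + 2 * h) + (1/2 - h) * ln (1 - 2 * h)"
proof -
  define f where "f = (\<lambda>h::real. (1/2 + h) * ln (1 + 2 * h) + (1/2 - h) * ln (1 - 2 * h) - 2 * h\<^sup>2)"
  define f' where "f' = (\<lambda>h::real. ln (1 + 2 * h) - ln (1 - 2 * h) - 4 * h)"
  have df: "(f has_real_derivative f' t) (at t)" if "0 \<le> t" "t < 1/2" for t
    unfolding f_def f'_def using that
    by (auto intro!: derivative_eq_intros simp: divide_simps) (simp add: algebra_simps)
  have df': "(f' has_real_derivative (2 / (1 + 2 * t) + 2 / (1 - 2 * t) - 4)) (at t)" if "0 \<le> t" "t < 1/2" for t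
    unfolding f'_def using that by (auto intro!: derivative_eq_intros)
  have pos: "0 \<le> f' t" if "0 \<le> t" "t < 1/2" for t
  proof -
    have "f' 0 \<le> f' t"
    proof (rule DERIV_nonneg_imp_nondecreasing[OF that(1)])
      fix s assume s: "0 \<le> s" "s \<le> t"
      have "2 / (1 + 2 * s) + 2 / (1 - 2 * s) - 4 = 16 * s\<^sup>2 / ((1 + 2 * s) * (1 - 2 * s))"
        using s that by (simp add: divide_simps) (simp add: algebra_simps power2_eq_square)
      also have "\<dots> \<ge> 0" using s that by (intro divide_nonneg_nonneg mult_nonneg_nonneg) auto
      finally show "\<exists>y. (f' has_real_derivative y) (at s) \<and> 0 \<le> y" using df'[of s] s that by auto
    qed
    thus ?thesis by (simp add: f'_def)
  qed
  have "f 0 \<le> f h"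
  proof (rule DERIV_nonneg_imp_nondecreasing[OF assms(1)])
    fix s assume "0 \<le> s" "s \<le> h"
    thus "\<exists>y. (f has_real_derivative y) (at s) \<and> 0 \<le> y" using df pos assms by force
  qed
  thus ?thesis by (simp add: f_def)
qed

text \<open>
  Cuts below \<open>(d/2 - 9/10 * sqrt d) * card S\<close> are excluded instead of \<open>(d/2 - sqrt d) * card S\<close>; the spare
  \<open>sqrt d / 10 * card S\<close> absorbs all additive constants, and \<open>2 * (9/10)^2 > 2 * ln 2\<close> still holds.
\<close>

lemma slack_bounds:
  assumes "4 \<le> D" "h = 9 / 10 / sqrt D"
  shows "2 \<le> sqrt D" "0 < h" "h < 1 / 2"
proof -
  show sq: "2 \<le> sqrt D" using assms by (intro real_le_rsqrt) auto
  show "0 < h" using sq unfolding assms(2) by (intro divide_pos_pos) linarith+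
  have "9 / 10 / sqrt D \<le> 9 / 10 / 2" using sq assms(1) by (intro divide_left_mono) auto
  thus "h < 1 / 2" using assms(2) by simp
qed

text \<open>At 1/2 the cut rate is twice the binary divergence, so Pinsker gives at least
  \<open>2 * D * h^2 = 1.62\<close>, against \<open>2 * ln 2 <= 25 / 18\<close>.\<close>

lemma rate_half:
  assumes D: "4 \<le> D" and h: "h = 9 / 10 / sqrt D"
  shows "1 / 5 \<le> D / 2 * cut_rate (1/2 - h) (1/2) - entropy_rate (1/2)"
proof -
  note sq = slack_bounds(1)[OF D h] and h' = slack_bounds(2,3)[OF D h]
  have "D * h\<^sup>2 = 81/100" using D h by (simp add: power_divide)
  have l: "ln (1/2 + h) = ln (1 + 2 * h) - ln 2" "ln (1/2 - h) = ln (1 - 2 * h) - ln 2"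
    using h' ln_div[of "1 + 2 * h" 2] ln_div[of "1 - 2 * h" 2]
    by (simp_all add: add_divide_distrib diff_divide_distrib)
  have q: "ln (1 - 1/2 * (1 + (1/2 - h))) = ln (1 + 2 * h) - 2 * ln 2"
  proof -
    have "1 - 1/2 * (1 + (1/2 - h)) = (1 + 2 * h) / (2 * 2)" by (simp add: field_simps)
    hence "ln (1 - 1/2 * (1 + (1/2 - h))) = ln ((1 + 2 * h) / (2 * 2))" by metis
    moreover have "ln (4 :: real) = 2 * ln 2" using ln_mult[of 2 "2 :: real"] by simp
    ultimately show ?thesis using h' by (subst (asm) ln_div) auto
  qed
  have "cut_rate (1/2 - h) (1/2) = 2 * ((1/2 + h) * ln (1 + 2 * h) + (1/2 - h) * ln (1 - 2 * h))"
  proof -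
    have r: "1 - (1/2 - h) = 1/2 + h" "1 - 1/2 = (1/2 :: real)" by simp_all
    have l2: "ln (1/2 :: real) = - ln 2" by (simp add: ln_div)
    define P Q T where "P = ln (1 + 2 * h)" and "Q = ln (1 - 2 * h)" and "T = ln (2 :: real)"
    show ?thesis
      unfolding cut_rate_def q r l l2 P_def[symmetric] Q_def[symmetric] T_def[symmetric]
      by (simp add: field_simps)
  qed
  hence "4 * h\<^sup>2 \<le> cut_rate (1/2 - h) (1/2)" using binary_pinsker[of h] h' by simp
  hence "D / 2 * (4 * h\<^sup>2) \<le> D / 2 * cut_rate (1/2 - h) (1/2)" using D by (intro mult_left_mono) auto
  moreover have "D / 2 * (4 * h\<^sup>2) = 2 * (D * h\<^sup>2)" by simp
  moreover have "entropy_rate (1/2) = 2 * ln 2" by (simp add: entropy_rate_def ln_div)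
  ultimately show ?thesis using \<open>D * h\<^sup>2 = _\<close> ln2_le_25_over_36 by simp
qed

text \<open>By convexity of the power function it suffices to compare at \<open>\<alpha> = 0\<close> and \<open>\<alpha> = 1/2\<close>.\<close>

lemma rate_derivative_sign:
  assumes D: "4 \<le> D" and h: "h = 9 / 10 / sqrt D" and \<alpha>: "0 < \<alpha>" "\<alpha> \<le> 1/2"
  shows "(D - 1) * ln (1 - \<alpha>) \<le> D / 2 * ln (1 - \<alpha> * (1 + (1/2 - h)))"
proof -
  note sq = slack_bounds(1)[OF D h] and h' = slack_bounds(2,3)[OF D h]
  \<comment> \<open>Since \<open>D / 2 * p = D - 1\<close>, the claim becomes
    \<open>(1 - \<alpha>) powr p <= 1 - \<alpha> * (3/2 - h)\<close>. At 1/2 this says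
    \<open>2 powr (2 / D) <= 1 + 2 * h\<close>.\<close>
  define p where "p = 2 - 2 / D"
  have p: "1 \<le> p" using D by (auto simp: p_def divide_simps)
  have "2 / D \<le> 1 / sqrt D"
  proof -
    have "2 * sqrt D \<le> sqrt D * sqrt D" using sq D by (intro mult_right_mono) auto
    thus ?thesis using D by (simp add: divide_simps)
  qed
  hence "2 powr (2 / D) \<le> 2 powr (1 / sqrt D)" by (intro powr_mono) auto
  also have "\<dots> \<le> 1 + 1 / sqrt D" using sq D by (intro two_powr_le) (auto simp: divide_le_eq)
  also have "\<dots> \<le> 1 + (9 / 5) / sqrt D" using D by (intro add_left_mono divide_right_mono) auto
  also have "\<dots> = 1 + 2 * h" by (simp add: h)
  finally have "2 powr (2 / D) / 4 \<le> 1/4 + h/2" by simp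
  moreover have "(1/2) powr p = 2 powr (2 / D) / 4"
    by (simp add: p_def powr_diff powr_divide)
  ultimately have half: "(1/2) powr p \<le> 1/4 + h/2" by simp
  have "((1 - 2 * \<alpha>) *\<^sub>R 1 + (2 * \<alpha>) *\<^sub>R (1/2)) powr p
      \<le> (1 - 2 * \<alpha>) * 1 powr p + (2 * \<alpha>) * (1/2) powr p"
    using \<alpha> by (intro convex_onD[OF powr_convex[OF p]]) auto
  hence "(1 - \<alpha>) powr p \<le> (1 - 2 * \<alpha>) + (2 * \<alpha>) * (1/2) powr p" by simp
  also have "\<dots> \<le> (1 - 2 * \<alpha>) + (2 * \<alpha>) * (1/4 + h/2)"
    using half \<alpha> by (intro add_left_mono mult_left_mono) auto
  also have "\<dots> = 1 - \<alpha> * (1 + (1/2 - h))" by (simp add: algebra_simps)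
  finally have "ln ((1 - \<alpha>) powr p) \<le> ln (1 - \<alpha> * (1 + (1/2 - h)))"
    using \<alpha> by (intro ln_mono) auto
  hence "D / 2 * (p * ln (1 - \<alpha>)) \<le> D / 2 * ln (1 - \<alpha> * (1 + (1/2 - h)))"
    using D \<alpha> by (intro mult_left_mono) (auto simp: ln_powr)
  moreover have "D / 2 * p = D - 1" using D by (simp add: p_def field_simps)
  ultimately show ?thesis by (metis mult.assoc)
qed

lemma rate_bound:
  assumes D: "4 \<le> D" and h: "h = 9 / 10 / sqrt D" and \<alpha>: "0 < \<alpha>" "\<alpha> \<le> 1/2"
  shows "1 / 5 \<le> D / 2 * cut_rate (1/2 - h) \<alpha> - entropy_rate \<alpha>"
proof -
  note sq = slack_bounds(1)[OF D h] and h' = slack_bounds(2,3)[OF D h]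
  define f where "f = (\<lambda>\<alpha>. D / 2 * cut_rate (1/2 - h) \<alpha> - entropy_rate \<alpha>)"
  have "f (1/2) \<le> f \<alpha>"
  proof (rule DERIV_nonpos_imp_nonincreasing[OF \<alpha>(2)])
    fix s assume s: "\<alpha> \<le> s" "s \<le> 1/2"
    have s': "0 < s" "s < 1" using s \<alpha> by auto
    have "s * (1 + (1/2 - h)) \<le> 1/2 * (1 + (1/2 - h))" using s h' by (intro mult_right_mono) auto
    also have "\<dots> < 1" using h' by simp
    finally have s3: "s * (1 + (1/2 - h)) < 1" .
    let ?L = "ln (1 - s * (1 + (1/2 - h)))"
    have der: "(f has_real_derivative
       (D / 2 * ((2 * ln (1 - s) - ?L) / s\<^sup>2) - ln (1 - s) / s\<^sup>2)) (at s)"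
      unfolding f_def
      by (intro DERIV_diff DERIV_cmult cut_rate_has_derivative entropy_rate_has_derivative s' s3)
    have eq: "D / 2 * ((2 * K - L) / q) - K / q = ((D - 1) * K - D / 2 * L) / q" for K L q :: real
      by (cases "q = 0") (auto simp: field_simps)
    have "(D - 1) * ln (1 - s) - D / 2 * ?L \<le> 0" using rate_derivative_sign[OF D h s'(1) s(2)] by simp
    hence "((D - 1) * ln (1 - s) - D / 2 * ?L) / s\<^sup>2 \<le> 0" by (intro divide_nonpos_nonneg) auto
    thus "\<exists>y. (f has_real_derivative y) (at s) \<and> y \<le> 0" using der unfolding eq by blast
  qed
  thus ?thesis using rate_half[OF D h] unfolding f_def by linarith
qed

section \<open>The first moment exponent of a fixed cut\<close>

lemma psi_gap:
  fixes D :: real and s n :: nat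
  assumes D: "0 < D" and s: "0 < s" "2 * s \<le> n" and x: "0 < x" "x < 1/2"
  defines "a \<equiv> D * real s" and "b \<equiv> D * (real n - real s)"
  shows "psi a b (a * b / (a + b)) - psi a b (a * x) = a * cut_rate x (real s / real n)"
proof -
  define \<alpha> where "\<alpha> = real s / real n"
  define N where "N = D * real n"
  have n: "0 < real n" "2 * real s \<le> real n" using s by linarith+
  have \<alpha>: "0 < \<alpha>" "\<alpha> \<le> 1/2" using n s by (auto simp: \<alpha>_def divide_simps)
  have N: "0 < N" using D n by (simp add: N_def)
  have a: "a = N * \<alpha>" "b = N * (1 - \<alpha>)" "a + b = N"
    using n by (auto simp: a_def b_def N_def \<alpha>_def field_simps)
  have "\<alpha> * (1 + x) \<le> 1/2 * (1 + x)" using \<alpha> x by (intro mult_right_mono) auto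
  also have "\<dots> < 1" using x by simp
  finally have w: "0 < 1 - \<alpha> * (1 + x)" by simp
  define w where "w = 1 - \<alpha> * (1 + x)"
  define lN lw la lb where "lN = ln N" and "lw = ln w" and "la = ln \<alpha>" and "lb = ln (1 - \<alpha>)"
  have z: "a * b / (a + b) = N * (\<alpha> * (1 - \<alpha>))" unfolding a(3) using N by (simp add: a(1,2))
  have z2: "a - N * (\<alpha> * (1 - \<alpha>)) = N * (\<alpha> * \<alpha>)" "b - N * (\<alpha> * (1 - \<alpha>)) = N * ((1 - \<alpha>) * (1 - \<alpha>))"
    by (auto simp: a algebra_simps)
  have lz: "ln (N * (\<alpha> * (1 - \<alpha>))) = lN + (la + lb)" "ln (N * (\<alpha> * \<alpha>)) = lN + (la + la)"
      "ln (N * ((1 - \<alpha>) * (1 - \<alpha>))) = lN + (lb + lb)"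
    using N \<alpha> by (simp_all add: ln_mult lN_def la_def lb_def)
  have y: "a - a * x = N * (\<alpha> * (1 - x))" "b - a * x = N * w" "a * x = N * (\<alpha> * x)"
    by (auto simp: a w_def algebra_simps)
  have ly: "ln (N * (\<alpha> * (1 - x))) = lN + (la + ln (1 - x))" "ln (N * w) = lN + lw"
      "ln (N * (\<alpha> * x)) = lN + (la + ln x)"
    using N \<alpha> x w by (simp_all add: ln_mult lN_def la_def lw_def w_def)
  have cr: "a * cut_rate x \<alpha> = N * (\<alpha> * (1 - x) * ln (1 - x) + 2 * \<alpha> * x * ln x - \<alpha> * (1 - x) * la
      + 2 * \<alpha> * lb + w * lw - 2 * lb)"
  proof -
    define r q where "r = 1 / \<alpha> - (1 + x)" and "q = 2 / \<alpha>"
    have rq: "w = \<alpha> * r" "\<alpha> * q = 2" using \<alpha> by (simp_all add: w_def r_def q_def field_simps)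
    show ?thesis
      unfolding cut_rate_def a(1) w_def[symmetric] lw_def[symmetric] la_def[symmetric] lb_def[symmetric]
        r_def[symmetric] q_def[symmetric]
      using rq(2) unfolding rq(1) by (simp add: algebra_simps)
  qed
  \<comment> \<open>The \<open>ln N\<close> terms cancel because the coefficients of the logarithms
    in \<open>psi\<close> add up to \<open>- (a + b)\<close> for every \<open>y\<close>.\<close>
  show ?thesis
    unfolding \<alpha>_def[symmetric] cr unfolding psi_def z y(1,2)
    unfolding y(3) z2 lz ly by (simp add: w_def algebra_simps)
qed

text \<open>A single term in the expansion of \<open>(\<alpha> + (1 - \<alpha>)) ^ n = 1\<close> is
  at most 1.\<close>

lemma binomial_le_entropy:
  assumes s: "0 < s" "s < n"
  shows "real (n choose s) \<le> exp (real s * entropy_rate (real s / real n))"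
proof -
  define \<alpha> where "\<alpha> = real s / real n"
  have \<alpha>: "0 < \<alpha>" "\<alpha> < 1" using s by (auto simp: \<alpha>_def)
  have "real (n choose s) * \<alpha> ^ s * (1 - \<alpha>) ^ (n - s)
      \<le> (\<Sum>k\<le>n. real (n choose k) * \<alpha> ^ k * (1 - \<alpha>) ^ (n - k))"
    using \<alpha> s by (intro member_le_sum) auto
  also have "\<dots> = (\<alpha> + (1 - \<alpha>)) ^ n" by (simp only: binomial_ring)
  finally have le: "real (n choose s) * (\<alpha> ^ s * (1 - \<alpha>) ^ (n - s)) \<le> 1" by (simp add: mult.assoc)
  have "real s * entropy_rate \<alpha> = - (real s * ln \<alpha>) - real (n - s) * ln (1 - \<alpha>)"
  proof -
    have "real s * (1 / \<alpha> - 1) = real (n - s)" using s by (simp add: \<alpha>_def field_simps of_nat_diff)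
    moreover have "real s * entropy_rate \<alpha> = - (real s * ln \<alpha>) - (real s * (1 / \<alpha> - 1)) * ln (1 - \<alpha>)"
      by (simp add: entropy_rate_def algebra_simps)
    ultimately show ?thesis by simp
  qed
  moreover have "exp (real s * ln \<alpha>) = \<alpha> ^ s" "exp (real (n - s) * ln (1 - \<alpha>)) = (1 - \<alpha>) ^ (n - s)"
    using \<alpha> by (simp_all add: exp_of_nat_mult)
  ultimately have "exp (real s * entropy_rate \<alpha>) = 1 / (\<alpha> ^ s * (1 - \<alpha>) ^ (n - s))"
    by (simp only: exp_diff exp_minus) (simp add: divide_inverse)
  moreover have "0 < \<alpha> ^ s * (1 - \<alpha>) ^ (n - s)" using \<alpha> by simp
  ultimately show ?thesis using le unfolding \<alpha>_def[symmetric] by (simp add: pos_le_divide_eq)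
qed

text \<open>The allowed cut size is \<open>a * (1/2 - h)\<close>, below the equilibrium as
  \<open>a <= b\<close>. By \<open>psi_gap\<close> the exponent of the product is \<open>c\<close>
  minus \<open>s\<close> times a gap of at least 1/5.\<close>

lemma binomial_times_switching_bound:
  fixes p :: "nat \<Rightarrow> real" and D c :: real and n s :: nat
  assumes p: "\<And>k. 0 \<le> p k" "\<And>k. p k \<le> 1"
    and step: "\<And>k. p k * ((D * real s - real k) * (D * (real n - real s) - real k - c))
       \<le> p (k + 2) * (real (k + 2) * real (k + 1))"
    and D: "4 \<le> D" and c: "0 \<le> c" "8 * c \<le> D * real n" and s: "0 < s" "2 * s \<le> n"
    and k: "real k + 2 \<le> real s * (D / 2 - 9/10 * sqrt D)"
  shows "real (n choose s) * p k \<le> exp (c - real s / 5)"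
proof -
  define h where "h = 9 / 10 / sqrt D"
  define a b where "a = D * real s" and "b = D * (real n - real s)"
  let ?\<alpha> = "real s / real n" and ?z = "a * b / (a + b)"
  note sq = slack_bounds(1)[OF D h_def] and h' = slack_bounds(2,3)[OF D h_def]
  have n: "0 < real n" "2 * real s \<le> real n" using s by linarith+
  have \<alpha>: "0 < ?\<alpha>" "?\<alpha> \<le> 1/2" using n s by (auto simp: divide_simps)
  have ab: "0 < a" "a \<le> b" "a + b = D * real n"
  proof -
    show "0 < a" using D s by (simp add: a_def)
    show "a \<le> b" unfolding a_def b_def using D n by (intro mult_left_mono) auto
  qed (simp add: a_def b_def algebra_simps)
  have "D * h = 9/10 * (D / sqrt D)" by (simp add: h_def)
  also have "\<dots> = 9/10 * sqrt D" using D by (simp add: real_div_sqrt)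
  finally have "D * h = 9/10 * sqrt D" .
  hence y: "real s * (D / 2 - 9/10 * sqrt D) = a * (1/2 - h)" by (simp add: a_def algebra_simps)
  have "a * (1/2 - h) \<le> a * (1/2)" using ab h' by (intro mult_left_mono) auto
  also have "\<dots> \<le> ?z"
  proof -
    have "a * (a + b) \<le> a * (2 * b)" using ab by (intro mult_left_mono) auto
    thus ?thesis using ab by (simp add: pos_le_divide_eq)
  qed
  finally have yz: "a * (1/2 - h) \<le> ?z" .
  have "p k \<le> exp ((psi a b (a * (1/2 - h)) - psi a b ?z) / 2 + c)"
  proof (rule switching_bound[OF p _ ab(1,2) c(1) _ _ yz])
    show "p k * ((a - real k) * (b - real k - c)) \<le> p (k + 2) * (real (k + 2) * real (k + 1))" for k
      unfolding a_def b_def by (rule step)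
    show "8 * c \<le> a + b" unfolding ab(3) by (rule c(2))
    show "real k + 2 \<le> a * (1/2 - h)" using k unfolding y .
  qed
  also have "psi a b (a * (1/2 - h)) - psi a b ?z = - (a * cut_rate (1/2 - h) ?\<alpha>)"
    using psi_gap[of D s n "1/2 - h"] D s h' by (simp add: a_def b_def)
  finally have "p k \<le> exp (c - real s * (D / 2 * cut_rate (1/2 - h) ?\<alpha>))"
    by (simp add: a_def algebra_simps)
  hence "real (n choose s) * p k \<le> exp (real s * entropy_rate ?\<alpha>) * exp (c - real s * (D / 2 * cut_rate (1/2 - h) ?\<alpha>))"
    using p s by (intro mult_mono binomial_le_entropy) auto
  also have "\<dots> = exp (c - real s * (D / 2 * cut_rate (1/2 - h) ?\<alpha> - entropy_rate ?\<alpha>))"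
    by (simp add: algebra_simps flip: exp_add)
  also have "\<dots> \<le> exp (c - real s * (1/5))"
  proof -
    have "real s * (1/5) \<le> real s * (D / 2 * cut_rate (1/2 - h) ?\<alpha> - entropy_rate ?\<alpha>)"
      using rate_bound[OF D h_def \<alpha>] by (intro mult_left_mono) auto
    thus ?thesis by simp
  qed
  finally show ?thesis by simp
qed

section \<open>The union bound over cuts\<close>

definition cut_prob :: "nat \<Rightarrow> nat \<Rightarrow> nat set \<Rightarrow> nat \<Rightarrow> real" where
  "cut_prob d n A k = real (card (cut_graphs d n A k)) / real (card (regular_graphs d n))"

lemma cut_prob_nonneg: "0 \<le> cut_prob d n A k"
  by (simp add: cut_prob_def)

lemma cut_prob_le_1: "cut_prob d n A k \<le> 1"
proof -
  have "card (cut_graphs d n A k) \<le> card (regular_graphs d n)"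
    by (intro card_mono finite_regular_graphs) (auto simp: cut_graphs_def)
  thus ?thesis by (simp add: cut_prob_def divide_le_eq)
qed

lemma cut_prob_step:
  assumes "A \<subseteq> {1..n}" "card A = s"
  shows "cut_prob d n A k * ((real d * real s - real k) *
      (real d * (real n - real s) - real k - 2 * real d ^ 2))
    \<le> cut_prob d n A (k + 2) * (real (k + 2) * real (k + 1))"
proof -
  have "s \<le> n" using card_mono[OF _ assms(1)] assms(2) by simp
  hence "real (n - s) = real n - real s" by (rule of_nat_diff)
  thus ?thesis
    using divide_right_mono[OF card_cut_graphs_switching[OF assms(1), of d k], of "real (card (regular_graphs d n))"]
    by (simp add: cut_prob_def assms(2))
qed

text \<open>One step gains \<open>(d * s)^2\<close> over \<open>d * n / 2\<close>; the factor
  \<open>d * s - k\<close> is merely bounded below by 1.\<close>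

lemma cut_prob_small_set:
  assumes A: "A \<subseteq> {1..n}" "card A = s" and d: "0 < d" and n: "4 * s + 4 * d \<le> n"
    and s: "0 < s"
  shows "k + 2 * m \<le> d * s \<Longrightarrow> cut_prob d n A k \<le> (2 * real d * real s ^ 2 / real n) ^ m"
proof (induction m arbitrary: k)
  case 0
  show ?case using cut_prob_le_1 by simp
next
  case (Suc m)
  let ?p = "cut_prob d n A"
  have nn: "0 < real n" using n d by simp
  have k: "real k + 2 \<le> real d * real s"
  proof -
    have "k + 2 \<le> d * s" using Suc.prems by simp
    hence "real (k + 2) \<le> real (d * s)" by (rule of_nat_mono)
    thus ?thesis by simp
  qed
  have "real (4 * s + 4 * d) \<le> real n" using n by (rule of_nat_mono)
  hence "real n / 2 \<le> real n - 2 * real s - 2 * real d" by simp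
  hence "real d * (real n / 2) \<le> real d * (real n - 2 * real s - 2 * real d)"
    by (intro mult_left_mono) auto
  also have "\<dots> \<le> real d * (real n - real s) - real k - 2 * real d ^ 2"
    using k by (simp add: algebra_simps power2_eq_square)
  finally have B: "real d * (real n / 2) \<le> real d * (real n - real s) - real k - 2 * real d ^ 2" .
  have "?p k * (1 * (real d * (real n / 2)))
      \<le> ?p k * ((real d * real s - real k) * (real d * (real n - real s) - real k - 2 * real d ^ 2))"
    using B k d nn by (intro mult_left_mono mult_mono cut_prob_nonneg) auto
  also have "\<dots> \<le> ?p (k + 2) * (real (k + 2) * real (k + 1))" by (rule cut_prob_step[OF A])
  also have "\<dots> \<le> ?p (k + 2) * ((real d * real s) * (real d * real s))"
    using k by (intro mult_left_mono mult_mono cut_prob_nonneg) auto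
  finally have "?p k \<le> ?p (k + 2) * (2 * real d * real s ^ 2 / real n)"
    using d nn by (simp add: field_simps power2_eq_square)
  also have "\<dots> \<le> (2 * real d * real s ^ 2 / real n) ^ m * (2 * real d * real s ^ 2 / real n)"
    using Suc.prems by (intro mult_right_mono Suc.IH) auto
  finally show ?case by (simp add: mult.commute)
qed

definition slack_degree :: "nat \<Rightarrow> nat" where
  "slack_degree d = nat \<lfloor>real d / 2 - sqrt (real d)\<rfloor>"

text \<open>The distance 4 comes from \<open>d / 2 + sqrt d >= 4\<close>. It leaves room for
  \<open>2 * (s - 1)\<close> switchings and settles sets of at most four vertices.\<close>

lemma slack_degree:
  assumes d: "4 \<le> d"
  shows "real (slack_degree d) \<le> real d / 2 - sqrt (real d)" "slack_degree d + 4 \<le> d"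
proof -
  have sq: "2 \<le> sqrt (real d)" using d by (intro real_le_rsqrt) auto
  hence "sqrt (real d) * 2 \<le> sqrt (real d) * sqrt (real d)" by (intro mult_left_mono) auto
  hence pos: "0 \<le> real d / 2 - sqrt (real d)" by simp
  thus 1: "real (slack_degree d) \<le> real d / 2 - sqrt (real d)" unfolding slack_degree_def by simp
  show "slack_degree d + 4 \<le> d"
    using 1 sq pos by linarith
qed

lemma slack_degree_greatest:
  "real D \<le> real d / 2 - sqrt (real d) \<Longrightarrow> D \<le> slack_degree d"
  unfolding slack_degree_def by linarith

text \<open>The product is at most \<open>n * (n * q^2)^(s - 1)\<close> with
  \<open>n * q^2 = 4 * d^2 * s^4 / n <= 1\<close>. As \<open>s >= 5\<close>, four factors give order
  \<open>s^16 / n^3\<close>, and \<open>s^16 <= sqrt n\<close>. The resulting power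
  \<open>-5/2\<close> of \<open>n\<close> beats the at most \<open>d * n^2\<close> pairs of set size
  and cut size.\<close>

lemma binomial_cut_prob_small:
  assumes A: "A \<subseteq> {1..n}" "card A = s" and d: "4 \<le> d" and s: "5 \<le> s" "s ^ 32 \<le> n"
    and n: "16 * d ^ 4 \<le> n" and k: "k < d + slack_degree d * (s - 1)"
  shows "real (n choose s) * cut_prob d n A k \<le> 256 * real d ^ 8 * sqrt (real n) / real n ^ 3"
proof -
  define q where "q = 2 * real d * real s ^ 2 / real n"
  have nn: "0 < real n" using n d by (simp add: order_less_le_trans[rotated])
  have n8: "4 * s + 4 * d \<le> n"
  proof -
    have "8 * s \<le> s ^ 31 * s" using s(1) power_mono[OF s(1), of 31] by (intro mult_right_mono) auto
    also have "\<dots> = s ^ 32" by (simp flip: power_Suc2)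
    finally have "8 * s \<le> n" using s(2) by simp
    moreover have "d * 1 \<le> d * d ^ 3" using d by (intro mult_left_mono) auto
    hence "8 * d \<le> n" using n by (simp flip: power_Suc)
    ultimately show ?thesis by simp
  qed
  have "k + 2 * (2 * (s - 1)) \<le> d * s"
  proof -
    obtain t where t: "s = t + 1" using s(1) by (metis add.commute le_add_diff_inverse le_trans one_le_numeral)
    have "(slack_degree d + 4) * t \<le> d * t" using slack_degree(2)[OF d] by (rule mult_right_mono) simp
    thus ?thesis using k unfolding t by (simp add: algebra_simps)
  qed
  hence p: "cut_prob d n A k \<le> q ^ (2 * (s - 1))"
    unfolding q_def using A d n8 s by (intro cut_prob_small_set) auto
  have s16: "real s ^ 16 \<le> sqrt (real n)"
  proof (rule real_le_rsqrt)
    have "(real s ^ 16)\<^sup>2 = real (s ^ 32)" by (simp flip: power_mult)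
    thus "(real s ^ 16)\<^sup>2 \<le> real n" using s(2) by simp
  qed
  have nq: "real n * q\<^sup>2 = 4 * real d ^ 2 * real s ^ 4 / real n"
    using nn by (simp add: q_def power_divide power_mult_distrib field_simps power2_eq_square power4_eq_xxxx)
  have "4 * real d ^ 2 * real s ^ 4 \<le> sqrt (real n) * sqrt (real n)"
  proof (rule mult_mono)
    show "4 * real d ^ 2 \<le> sqrt (real n)"
    proof (rule real_le_rsqrt)
      have "(4 * real d ^ 2)\<^sup>2 = real (16 * d ^ 4)" by (simp add: power_mult_distrib flip: power_mult)
      thus "(4 * real d ^ 2)\<^sup>2 \<le> real n" using n by (simp only: of_nat_le_iff)
    qed
    have "real s ^ 4 \<le> real s ^ 16" using s(1) by (intro power_increasing) auto
    thus "real s ^ 4 \<le> sqrt (real n)" using s16 by simp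
  qed auto
  hence nq1: "real n * q\<^sup>2 \<le> 1" using nn unfolding nq by simp
  have "n choose s \<le> n ^ s" using n8 by (intro binomial_le_pow) simp
  hence "real (n choose s) \<le> real n ^ s" by (simp flip: of_nat_power)
  hence "real (n choose s) * cut_prob d n A k \<le> real n ^ s * q ^ (2 * (s - 1))"
    using p cut_prob_nonneg by (intro mult_mono) auto
  also have "\<dots> = real n * (real n * q\<^sup>2) ^ (s - 1)"
  proof -
    have "real n ^ s = real n * real n ^ (s - 1)" using s(1) by (simp flip: power_Suc)
    thus ?thesis by (simp add: power_mult power_mult_distrib)
  qed
  also have "\<dots> \<le> real n * (real n * q\<^sup>2) ^ 4"
    using s(1) nq1 nn by (intro mult_left_mono power_decreasing) auto
  also have "\<dots> = 256 * real d ^ 8 * real s ^ 16 / real n ^ 3"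
    unfolding nq using nn by (simp add: power_divide power_mult_distrib field_simps flip: power_mult power_Suc)
  also have "\<dots> \<le> 256 * real d ^ 8 * sqrt (real n) / real n ^ 3"
    using s16 by (intro divide_right_mono mult_left_mono) auto
  finally show ?thesis .
qed

text \<open>Here \<open>s > 10 * (d + 1)\<close>, so the spare \<open>s * sqrt d / 10\<close>
  absorbs the additive \<open>d + 1\<close>, and the entropy comparison applies with
  \<open>c = 2 * d^2\<close>.\<close>

lemma binomial_cut_prob_large:
  assumes A: "A \<subseteq> {1..n}" "card A = s" and d: "4 \<le> d" and s: "n < s ^ 32" "2 * s \<le> n"
    and n: "16 * d ^ 4 \<le> n" "(10 * (d + 1)) ^ 32 \<le> n" and k: "k < d + slack_degree d * (s - 1)"
  shows "real (n choose s) * cut_prob d n A k \<le> exp (2 * real d ^ 2 - real n powr (1 / 32) / 5)"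
proof -
  have "(10 * (d + 1)) ^ 32 < s ^ 32" using n(2) s(1) by (rule le_less_trans)
  hence s10: "10 * (d + 1) < s" by (rule power_less_imp_less_base) simp
  have sq: "1 \<le> sqrt (real d)" using d by simp
  have "real (n choose s) * cut_prob d n A k \<le> exp (2 * real d ^ 2 - real s / 5)"
  proof (rule binomial_times_switching_bound[OF cut_prob_nonneg cut_prob_le_1 cut_prob_step[OF A]])
    have "d * 1 \<le> d * d ^ 3" using d by (intro mult_left_mono) auto
    hence "16 * d \<le> n" using n(1) by (simp flip: power_Suc)
    hence "d * (16 * d) \<le> d * n" by (rule mult_left_mono) simp
    hence "real (d * (16 * d)) \<le> real (d * n)" by (rule of_nat_mono)
    thus "8 * (2 * real d ^ 2) \<le> real d * real n" by (simp add: power2_eq_square)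
    have "real k + 1 \<le> real d + real (slack_degree d) * real (s - 1)"
    proof -
      have "real (k + 1) \<le> real (d + slack_degree d * (s - 1))" using k by (intro of_nat_mono) simp
      thus ?thesis by simp
    qed
    also have "real (slack_degree d) * real (s - 1) \<le> (real d / 2 - sqrt (real d)) * real s"
      using slack_degree(1)[OF d] by (intro mult_mono) auto
    finally have "real k + 2 \<le> real d + 1 + (real d / 2 - sqrt (real d)) * real s" by simp
    moreover have "real d + 1 \<le> real s / 10 * sqrt (real d)"
    proof -
      have "real d + 1 \<le> real s / 10 * 1" using s10 by simp
      also have "\<dots> \<le> real s / 10 * sqrt (real d)" using sq by (intro mult_left_mono) auto
      finally show ?thesis .
    qed
    ultimately show "real k + 2 \<le> real s * (real d / 2 - 9/10 * sqrt (real d))"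
      by (simp add: algebra_simps)
  qed (use d s s10 in auto)
  also have "\<dots> \<le> exp (2 * real d ^ 2 - real n powr (1 / 32) / 5)"
  proof -
    have "real n powr (1/32) \<le> (real s ^ 32) powr (1/32)"
      using s(1) by (intro powr_mono2) (simp_all flip: of_nat_power)
    also have "\<dots> = (real s powr 32) powr (1/32)" by simp
    also have "\<dots> = real s" unfolding powr_powr by simp
    finally show ?thesis by simp
  qed
  finally show ?thesis .
qed

text \<open>With at most \<open>s * (s - 1)\<close> ordered inner arcs, the cut has at least
  \<open>d + (d - s) * (s - 1)\<close> edges, and \<open>slack_degree d <= d - s\<close>.\<close>

lemma cut_small_set:
  assumes G: "G \<in> regular_graphs d n" and A: "A \<subseteq> {1..n}" "card A = s"
    and d: "4 \<le> d" and s: "1 \<le> s" "s \<le> 4"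
  shows "d + slack_degree d * (s - 1) \<le> card (arcs G A ({1..n} - A))"
proof -
  have finA: "finite A" using A(1) by (rule finite_subset) simp
  have "card (arcs G A A) \<le> card (A \<times> A - Id_on A)"
    using finA simple_graph_edgeD(3)[OF regular_graphsD(1)[OF G]]
    by (intro card_mono) (auto simp: arcs_def)
  also have "\<dots> = s * s - s"
  proof -
    have "Id_on A = (\<lambda>x. (x, x)) ` A" by (auto simp: Id_on_def)
    hence "card (Id_on A) = s" using A(2) by (simp add: card_image inj_on_def)
    moreover have "Id_on A \<subseteq> A \<times> A" "finite (Id_on A)" using finA by (auto simp: Id_on_def)
    ultimately show ?thesis using A(2) by (simp add: card_Diff_subset card_cartesian_product)
  qed
  finally have inner: "card (arcs G A A) \<le> s * s - s" .
  obtain t where t: "s = t + 1" using s(1) by (metis add.commute le_add_diff_inverse)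
  have "(slack_degree d + s) * t \<le> d * t"
    using slack_degree(2)[OF d] s(2) by (intro mult_right_mono) auto
  thus ?thesis using card_inner_arcs_regular[OF G A(1)] inner A(2) unfolding t
    by (simp add: algebra_simps)
qed

definition failure_bound :: "nat \<Rightarrow> nat \<Rightarrow> real" where
  "failure_bound d n = real n * (real d * real n) *
     (256 * real d ^ 8 * sqrt (real n) / real n ^ 3 + exp (2 * real d ^ 2 - real n powr (1 / 32) / 5))"

text \<open>Union bound over at most \<open>n\<close> sizes, the sets of each size, and at most
  \<open>d * n\<close> cut sizes. The \<open>n choose s\<close> sets of one size together cost at
  most \<open>B\<close> per cut size.\<close>

lemma not_expanding_fraction:
  assumes d: "3 \<le> d" and n: "16 * d ^ 4 \<le> n" "(10 * (d + 1)) ^ 32 \<le> n"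
  shows "real (card {G \<in> regular_graphs d n. \<not> expanding d n G}) / real (card (regular_graphs d n))
    \<le> failure_bound d n"
proof (cases "d = 3")
  case True
  have "sqrt 3 > (3/2 :: real)" by (rule real_less_rsqrt) (simp add: power2_eq_square)
  hence "expanding d n G" for G using True unfolding expanding_def by auto
  thus ?thesis by (simp add: failure_bound_def)
next
  case False
  hence d: "4 \<le> d" using d by simp
  define R where "R = real (card (regular_graphs d n))"
  define B where "B = 256 * real d ^ 8 * sqrt (real n) / real n ^ 3 + exp (2 * real d ^ 2 - real n powr (1 / 32) / 5)"
  define T where "T = (\<lambda>s. d + slack_degree d * (s - 1))"
  define I where "I = {s. 5 \<le> s \<and> 2 * s \<le> n}"
  define bad where "bad = {G \<in> regular_graphs d n. \<not> expanding d n G}"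
  have B0: "0 \<le> B" by (simp add: B_def)
  have finI: "finite I" by (rule finite_subset[of _ "{..n}"]) (auto simp: I_def)
  have fins: "finite (nsets {1..n} s)" for s by (simp add: finite_imp_finite_nsets)
  have finc: "finite (cut_graphs d n A k)" for A k
    unfolding cut_graphs_def using finite_regular_graphs by auto
  have "bad \<subseteq> (\<Union>s\<in>I. \<Union>A\<in>nsets {1..n} s. \<Union>k<T s. cut_graphs d n A k)"
  proof
    fix G assume "G \<in> bad"
    hence G: "G \<in> regular_graphs d n" "\<not> expanding d n G" by (auto simp: bad_def)
    then obtain S D where S: "S \<subseteq> {1..n}" "S \<noteq> {}" "2 * card S \<le> n"
      and D: "real D \<le> real d / 2 - sqrt (real d)"
      and lt: "card (arcs G S ({1..n} - S)) < d + D * (card S - 1)"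
      unfolding expanding_def by (meson not_le)
    have finS: "finite S" using S(1) by (rule finite_subset) simp
    have "D * (card S - 1) \<le> slack_degree d * (card S - 1)"
      using slack_degree_greatest[OF D] by (rule mult_right_mono) simp
    hence lt': "card (arcs G S ({1..n} - S)) < T (card S)" using lt unfolding T_def by linarith
    have "1 \<le> card S" using S(2) finS by (simp add: Suc_leI card_gt_0_iff)
    hence "\<not> card S \<le> 4" using cut_small_set[OF G(1) S(1) refl d] lt' by (auto simp: T_def)
    hence "card S \<in> I" using S(3) by (simp add: I_def)
    moreover have "S \<in> nsets {1..n} (card S)" using S(1) finS by (simp add: nsets_def)
    moreover have "G \<in> cut_graphs d n S (card (arcs G S ({1..n} - S)))" using G(1) by (simp add: cut_graphs_def)
    ultimately show "G \<in> (\<Union>s\<in>I. \<Union>A\<in>nsets {1..n} s. \<Union>k<T s. cut_graphs d n A k)"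
      using lt' by blast
  qed
  hence "card bad \<le> card (\<Union>s\<in>I. \<Union>A\<in>nsets {1..n} s. \<Union>k<T s. cut_graphs d n A k)"
    using finI fins finc by (intro card_mono finite_UN_I) auto
  also have "\<dots> \<le> (\<Sum>s\<in>I. card (\<Union>A\<in>nsets {1..n} s. \<Union>k<T s. cut_graphs d n A k))"
    by (rule card_UN_le[OF finI])
  also have "\<dots> \<le> (\<Sum>s\<in>I. \<Sum>A\<in>nsets {1..n} s. card (\<Union>k<T s. cut_graphs d n A k))"
    by (intro sum_mono card_UN_le fins)
  also have "\<dots> \<le> (\<Sum>s\<in>I. \<Sum>A\<in>nsets {1..n} s. \<Sum>k<T s. card (cut_graphs d n A k))"
    by (intro sum_mono card_UN_le) simp
  finally have "real (card bad) \<le> real (\<Sum>s\<in>I. \<Sum>A\<in>nsets {1..n} s. \<Sum>k<T s. card (cut_graphs d n A k))"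
    by (rule of_nat_mono)
  hence "real (card bad) / R \<le> (\<Sum>s\<in>I. \<Sum>A\<in>nsets {1..n} s. \<Sum>k<T s. real (card (cut_graphs d n A k))) / R"
    by (intro divide_right_mono) (simp_all add: R_def)
  also have "\<dots> = (\<Sum>s\<in>I. \<Sum>A\<in>nsets {1..n} s. \<Sum>k<T s. cut_prob d n A k)"
    by (simp add: cut_prob_def R_def sum_divide_distrib)
  also have "\<dots> \<le> (\<Sum>s\<in>I. real d * real n * B)"
  proof (rule sum_mono)
    fix s assume s: "s \<in> I"
    have c: "0 < real (n choose s)" using s by (simp add: I_def)
    have each: "cut_prob d n A k \<le> B / real (n choose s)" if A: "A \<in> nsets {1..n} s" and k: "k < T s" for A k
    proof -
      have A': "A \<subseteq> {1..n}" "card A = s" using A by (auto simp: nsets_def)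
      have "real (n choose s) * cut_prob d n A k \<le> B"
      proof (cases "s ^ 32 \<le> n")
        case True
        have "real (n choose s) * cut_prob d n A k \<le> 256 * real d ^ 8 * sqrt (real n) / real n ^ 3"
          using binomial_cut_prob_small[OF A' d _ True n(1)] s k by (simp add: I_def T_def)
        also have "\<dots> \<le> B" by (simp add: B_def)
        finally show ?thesis .
      next
        case False
        have "real (n choose s) * cut_prob d n A k \<le> exp (2 * real d ^ 2 - real n powr (1 / 32) / 5)"
          using binomial_cut_prob_large[OF A' d _ _ n] False s k by (simp add: I_def T_def)
        also have "\<dots> \<le> B" by (simp add: B_def)
        finally show ?thesis .
      qed
      thus ?thesis using c by (simp add: pos_le_divide_eq mult.commute)
    qed
    have "(\<Sum>A\<in>nsets {1..n} s. \<Sum>k<T s. cut_prob d n A k)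
        \<le> (\<Sum>A\<in>nsets {1..n} s. \<Sum>k<T s. B / real (n choose s))"
      using each by (intro sum_mono) auto
    also have "\<dots> = real (T s) * B" using c by (simp add: card_nsets)
    also have "\<dots> \<le> real (d * n) * B"
    proof (intro mult_right_mono of_nat_mono B0)
      obtain t where t: "s = t + 1" using s by (metis I_def mem_Collect_eq add.commute le_add_diff_inverse le_trans one_le_numeral)
      have "slack_degree d * t \<le> d * t" using slack_degree(2)[OF d] by (intro mult_right_mono) auto
      hence "T s \<le> d * s" by (simp add: T_def t)
      also have "\<dots> \<le> d * n" using s by (intro mult_left_mono) (auto simp: I_def)
      finally show "T s \<le> d * n" .
    qed
    finally show "(\<Sum>A\<in>nsets {1..n} s. \<Sum>k<T s. cut_prob d n A k) \<le> real d * real n * B" by simp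
  qed
  also have "\<dots> = real (card I) * (real d * real n * B)" by simp
  also have "\<dots> \<le> real n * (real d * real n * B)"
  proof (intro mult_right_mono of_nat_mono)
    have "I \<subseteq> {1..n}" by (auto simp: I_def)
    thus "card I \<le> n" using card_mono[of "{1..n}" I] by simp
  qed (use B0 in auto)
  finally show ?thesis unfolding bad_def R_def failure_bound_def B_def[symmetric] by (simp add: mult.assoc)
qed

text \<open>The first part has order \<open>n powr (-1/2)\<close>; in the second, a stretched
  exponential beats \<open>n^2\<close>.\<close>

lemma failure_bound_tendsto_0: "failure_bound d \<longlonglongrightarrow> 0"
proof -
  have "(\<lambda>n. real n * (c * real n) * (k * sqrt (real n) / real n ^ 3 + exp (m - real n powr (1 / 32) / 5)))
      \<longlonglongrightarrow> 0" for c k m :: real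
    by real_asymp
  from this[of "real d" "256 * real d ^ 8" "2 * real d ^ 2"]
  show ?thesis unfolding failure_bound_def[abs_def] by simp
qed

theorem theorem1:
  fixes d :: nat
  assumes "d \<ge> 3"
  shows "((\<lambda>n. measure_pmf.prob (random_regular_graph d n)
            {G. (\<forall>k::nat. real d / 2 + sqrt (real d) \<le> real k \<and> k \<le> d \<longrightarrow>
                   local_resilience G (edge_connected k) = d - k + 1) \<and>
                (\<forall>k::nat. 1 \<le> k \<and> real k < real d / 2 + sqrt (real d) \<longrightarrow>
                   real d / 2 - sqrt (real d) < real (local_resilience G (edge_connected k)) \<and>
                   real (local_resilience G (edge_connected k))
                     \<le> min (real d - real k + 1)
                           (real d / 2 + 4 * sqrt (real d * ln (real d))))})
          \<longlongrightarrow> 1) (inf sequentially (principal {n. even (d * n)}))"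
    (is "((\<lambda>n. measure_pmf.prob _ ?E) \<longlongrightarrow> 1) ?F")
proof (rule tendsto_sandwich)
  have "((\<lambda>n. 1 - failure_bound d n) \<longlongrightarrow> 1 - 0) sequentially"
    by (intro tendsto_intros failure_bound_tendsto_0)
  \<comment> \<open>\<open>?F\<close> only restricts to \<open>n\<close> with \<open>d * n\<close>
    even, so a limit along all \<open>n\<close> persists.\<close>
  thus "((\<lambda>n. 1 - failure_bound d n) \<longlongrightarrow> 1) ?F"
    by (intro tendsto_mono[of ?F sequentially]) auto
  show "((\<lambda>_. 1) \<longlongrightarrow> (1 :: real)) ?F" by simp
  show "\<forall>\<^sub>F n in ?F. measure_pmf.prob (random_regular_graph d n) ?E \<le> 1"
    by (simp add: measure_pmf.prob_le_1)
  have large: "\<forall>\<^sub>F n in sequentially. 16 * d ^ 4 \<le> n \<and> (10 * (d + 1)) ^ 32 \<le> n \<and> d < n \<and> 2 \<le> n"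
    by (intro eventually_conj eventually_ge_at_top eventually_gt_at_top)
  have "\<forall>\<^sub>F n in sequentially. even (d * n) \<longrightarrow>
      1 - failure_bound d n \<le> measure_pmf.prob (random_regular_graph d n) ?E"
    using large
  proof eventually_elim
    case (elim n)
    show ?case
    proof
      assume even: "even (d * n)"
      let ?R = "regular_graphs d n"
      let ?bad = "{G \<in> ?R. \<not> expanding d n G}"
      have R: "?R \<noteq> {}" "finite ?R"
        using regular_graphs_nonempty[OF _ even] finite_regular_graphs elim by auto
      have c: "0 < real (card ?R)" using R by (simp add: card_gt_0_iff)
      have "?R - ?bad \<subseteq> ?R \<inter> ?E"
      proof
        fix G assume "G \<in> ?R - ?bad"
        hence G: "G \<in> ?R" "expanding d n G" by auto
        have n: "2 \<le> n" using elim by simp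
        show "G \<in> ?R \<inter> ?E" using G(1) resilience_bounds_if_expanding[OF assms n G] by blast
      qed
      hence "card (?R - ?bad) \<le> card (?R \<inter> ?E)" using R by (intro card_mono) auto
      moreover have "card (?R - ?bad) = card ?R - card ?bad" using R by (intro card_Diff_subset) auto
      ultimately have "card ?R \<le> card (?R \<inter> ?E) + card ?bad" by linarith
      hence "real (card ?R) \<le> real (card (?R \<inter> ?E) + card ?bad)" by (rule of_nat_mono)
      hence "real (card ?R) / real (card ?R) \<le> real (card (?R \<inter> ?E) + card ?bad) / real (card ?R)"
        by (rule divide_right_mono) simp
      hence "1 \<le> real (card (?R \<inter> ?E)) / real (card ?R) + real (card ?bad) / real (card ?R)"
        using c by (simp add: add_divide_distrib)
      moreover have "real (card ?bad) / real (card ?R) \<le> failure_bound d n"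
        using elim by (intro not_expanding_fraction assms) auto
      moreover have "measure_pmf.prob (random_regular_graph d n) ?E = real (card (?R \<inter> ?E)) / real (card ?R)"
        unfolding random_regular_graph_def by (rule measure_pmf_of_set[OF R])
      ultimately show "1 - failure_bound d n \<le> measure_pmf.prob (random_regular_graph d n) ?E"
        by linarith
    qed
  qed
  thus "\<forall>\<^sub>F n in ?F. 1 - failure_bound d n \<le> measure_pmf.prob (random_regular_graph d n) ?E"
    unfolding eventually_inf_principal by simp
qed

end
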